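(* For every integer $k \ge 0$, $k\text{-}\mathrm{DEXPWOTIME} = k\text{-}\mathrm{EXPTIME}$.
   Context: Let $\exp_0(x)=x$ and $\exp_{j+1}(x)=2^{\exp_j(x)}$. $k\text{-}\mathrm{EXPTIME}$ is the class of languages decided by ordinary deterministic Turing machines in time $\exp_k(n^t)$ for some constant $t$. A write-once Turing machine is a Turing machine with a single tape, infinite in one direction, a single read/write head, and tape alphabet $\{0,1\}$ (0 = blank, 1 = marked), which may never write a blank onto a marked cell (re-marking a marked cell is allowed). $k\text{-}\mathrm{DEXPWOTIME}$ is the class of languages decided by deterministic write-once Turing machines in time $\exp_k(n^t)$ for some constant $t$. *)

theory Defs
  imports "HOL-Library.Landau_Symbols"
begin

datatype dir = GoLeft | Stay | GoRight

text \<open>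
  Deterministic Turing machines with one head on one tape whose cells are numbered 0, 1, 2, ...
  The tape alphabet consists of the numbers below \<open>num_symbols\<close>, and symbol 0 is the blank.
\<close>

record 'q tm =
  states :: "'q set"
  num_symbols :: nat
  start :: 'q
  accept :: 'q
  reject :: 'q
  delta :: "'q \<Rightarrow> nat \<Rightarrow> 'q \<times> nat \<times> dir"

definition wf_tm :: "'q tm \<Rightarrow> bool" where
  "wf_tm M \<longleftrightarrow>
     finite (states M) \<and> {start M, accept M, reject M} \<subseteq> states M \<and> accept M \<noteq> reject M \<and>
     (\<forall>q\<in>states M. \<forall>a<num_symbols M. delta M q a \<in> states M \<times> {..<num_symbols M} \<times> UNIV)"

text \<open>
  A configuration is a triple of state, head position and tape contents. A machine that tries to
  move left from cell 0 stays there.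
\<close>

type_synonym 'q config = "'q \<times> nat \<times> (nat \<Rightarrow> nat)"

fun move_head :: "dir \<Rightarrow> nat \<Rightarrow> nat" where
  "move_head GoLeft h = h - 1"
| "move_head Stay h = h"
| "move_head GoRight h = h + 1"

fun step :: "'q tm \<Rightarrow> 'q config \<Rightarrow> 'q config" where
  "step M (q, h, tape) =
     (if q = accept M \<or> q = reject M then (q, h, tape)
      else let (q', a, d) = delta M q (tape h) in (q', move_head d h, tape(h := a)))"

definition init_config :: "'q tm \<Rightarrow> nat list \<Rightarrow> 'q config" where
  "init_config M u = (start M, 0, \<lambda>i. if i < length u then u ! i else 0)"

text \<open>
  \<open>decides_in_time M enc L T\<close>: started on the tape inscription \<open>enc w\<close>, the machine reaches
  within \<open>T (length w)\<close> steps the accepting state if \<open>w\<close> is in \<open>L\<close> and the rejecting state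
  otherwise. Time is measured in the length of the word \<open>w\<close> itself.
\<close>

definition decides_in_time ::
  "'q tm \<Rightarrow> (bool list \<Rightarrow> nat list) \<Rightarrow> bool list set \<Rightarrow> (nat \<Rightarrow> nat) \<Rightarrow> bool" where
  "decides_in_time M enc L T \<longleftrightarrow>
     (\<forall>w. \<exists>m \<le> T (length w).
        fst ((step M ^^ m) (init_config M (enc w))) = (if w \<in> L then accept M else reject M))"

fun exp_tower :: "nat \<Rightarrow> nat \<Rightarrow> nat" where
  "exp_tower 0 x = x"
| "exp_tower (Suc j) x = 2 ^ exp_tower j x"

text \<open>
  The running time is understood up to a constant factor and for almost all lengths, as usual for
  DTIME classes; read literally, the bound \<open>n ^ t\<close> would leave no step at all for the empty word.
\<close>

definition exp_tower_bounded :: "nat \<Rightarrow> (nat \<Rightarrow> nat) \<Rightarrow> bool" where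
  "exp_tower_bounded k T \<longleftrightarrow>
     (\<exists>t. (\<lambda>n. real (T n)) \<in> O(\<lambda>n. real (exp_tower k (n ^ t))))"

text \<open>
  Languages are sets of binary words. An ordinary machine has at least the blank 0 and the two
  input letters 1 and 2 in its alphabet.
\<close>

definition input_tm :: "bool list \<Rightarrow> nat list" where
  "input_tm w = map (\<lambda>b. if b then 2 else 1) w"

definition ordinary_tm :: "'q tm \<Rightarrow> bool" where
  "ordinary_tm M \<longleftrightarrow> wf_tm M \<and> num_symbols M \<ge> 3"

definition k_EXPTIME :: "nat \<Rightarrow> bool list set set" where
  "k_EXPTIME k =
     {L. \<exists>(M :: nat tm) T. ordinary_tm M \<and> decides_in_time M input_tm L T \<and> exp_tower_bounded k T}"

definition write_once_tm :: "'q tm \<Rightarrow> bool" where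
  "write_once_tm M \<longleftrightarrow>
     wf_tm M \<and> num_symbols M = 2 \<and> (\<forall>q\<in>states M. fst (snd (delta M q 1)) = 1)"

text \<open>
  On the alphabet 0, 1 with 0 as the blank, the bits of a word cannot be put on the tape as they
  are: the words \<open>w\<close> and \<open>w\<close> followed by 0 would give the same tape, and a marked cell can
  never be altered again. So each bit occupies two cells, 01 for 0 and 10 for 1. The first blank
  pair then ends the input, and every input pair has one cell that can still be marked. (Codes
  with a fully marked pair, such as 11 for 1, are too weak: on inputs of the form 1...1 nothing in
  the input could be altered, so only regular properties of its length could be determined.)
\<close>

definition input_wotm :: "bool list \<Rightarrow> nat list" where
  "input_wotm w = concat (map (\<lambda>b. if b then [1, 0] else [0, 1]) w)"

definition k_DEXPWOTIME :: "nat \<Rightarrow> bool list set set" where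
  "k_DEXPWOTIME k =
     {L. \<exists>(M :: nat tm) T. write_once_tm M \<and> decides_in_time M input_wotm L T \<and> exp_tower_bounded k T}"

end

theory Submission
  imports Defs "HOL-Library.Countable"
begin

text \<open>
  A write-once machine with coded input is simulated step by step by an ordinary machine that
  holds two cells in one. Conversely, an ordinary machine is first turned into a device that
  rewrites a string over two letters in left-to-right passes: the string encodes the
  configuration, and one pass performs one step, holding back one cell for moves to the left.
  A write-once tape can carry such passes: each letter read is crossed out, and the new string is
  written behind the old one. Letters, crossing out, and blanks need four symbols, where a blank
  may become anything and a letter may only become crossed out; in two binary cells per symbol
  no mark is ever erased, and the coded input is the initial string. The slowdown is polynomial,
  and \<open>exp_tower k\<close> of a polynomial absorbs a polynomial for every \<open>k\<close>.
\<close>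

text \<open>A write-once cell changes at most once, so a configuration cannot be updated in place
  over a long run; every step has to be paid for by a fresh copy. Two binary cells leave only two
  letters besides the blank and the used symbol. Hence a cell over an arbitrary alphabet, together
  with the information whether the head is there, becomes a word over these two letters, decoded by
  a counter in the finite control. A left-to-right pass meets the left neighbour of the head before
  it knows the move; this is what forces one code to be held back. For the cost, let
  \<open>X\<close> be input length plus running time plus 1. A configuration has \<open>O(X)\<close>
  cells with codes of constant length, so all passes together read \<open>O(X^2)\<close> letters.
  Each letter costs a walk within a tape string whose length is also \<open>O(X^2)\<close>. This
  gives the exponent 4 of the slowdown.\<close>

lemma step_delta:
  assumes "delta M q (tape h) = (q', a, d)" "q \<noteq> accept M" "q \<noteq> reject M"
  shows "step M (q, h, tape) = (q', move_head d h, tape(h := a))"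
  using assms by simp

text \<open>Two implications suffice: \<open>M\<close> halts on every word with the right verdict,
  and \<open>M'\<close> only has to inherit it.\<close>

lemma decides_in_timeI:
  assumes "\<And>w m c. m \<le> T (length w) \<Longrightarrow> (step M ^^ m) (init_config M (enc w)) = c \<Longrightarrow>
      \<exists>m' \<le> T' (length w). \<exists>c'. (step M' ^^ m') (init_config M' (enc' w)) = c' \<and>
        (fst c = accept M \<longrightarrow> fst c' = accept M') \<and> (fst c = reject M \<longrightarrow> fst c' = reject M')"
    and "decides_in_time M enc L T"
  shows "decides_in_time M' enc' L T'"
  unfolding decides_in_time_def
proof
  fix w
  obtain m where "m \<le> T (length w)"
    and "fst ((step M ^^ m) (init_config M (enc w))) = (if w \<in> L then accept M else reject M)"
    using assms(2) unfolding decides_in_time_def by blast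
  then show "\<exists>m\<le>T' (length w). fst ((step M' ^^ m) (init_config M' (enc' w))) =
      (if w \<in> L then accept M' else reject M')"
    using assms(1)[of m w] by metis
qed

section \<open>Transport of states into the natural numbers, over which both classes quantify their
  machines\<close>

definition rename_tm :: "('q::countable) tm \<Rightarrow> nat tm" where
  "rename_tm M = \<lparr>states = to_nat ` states M, num_symbols = num_symbols M,
     start = to_nat (start M), accept = to_nat (accept M), reject = to_nat (reject M),
     delta = (\<lambda>q a. map_prod to_nat id (delta M (from_nat q) a))\<rparr>"

lemma wf_rename_tm: "wf_tm M \<Longrightarrow> wf_tm (rename_tm M)"
  by (fastforce simp: wf_tm_def rename_tm_def map_prod_def split: prod.splits)

lemma step_rename_tm: "step (rename_tm M) (map_prod to_nat id c) = map_prod to_nat id (step M c)"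
  by (cases c) (auto simp: rename_tm_def split: prod.splits)

lemma steps_rename_tm:
  "(step (rename_tm M) ^^ m) (map_prod to_nat id c) = map_prod to_nat id ((step M ^^ m) c)"
  by (induction m) (simp_all only: funpow_0 funpow.simps(2) comp_apply step_rename_tm)

lemma decides_rename_tm:
  assumes "decides_in_time M enc L T"
  shows "decides_in_time (rename_tm M) enc L T"
proof -
  have "init_config (rename_tm M) u = map_prod to_nat id (init_config M u)" for u
    by (simp add: init_config_def rename_tm_def)
  then have "fst ((step (rename_tm M) ^^ m) (init_config (rename_tm M) u)) =
      to_nat (fst ((step M ^^ m) (init_config M u)))" for m u
    by (simp only: steps_rename_tm fst_map_prod)
  moreover have "accept (rename_tm M) = to_nat (accept M)" "reject (rename_tm M) = to_nat (reject M)"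
    by (simp_all add: rename_tm_def)
  ultimately show ?thesis
    using assms unfolding decides_in_time_def by (metis (full_types))
qed

lemma ordinary_rename_tm: "ordinary_tm M \<Longrightarrow> ordinary_tm (rename_tm M)"
  by (simp add: ordinary_tm_def wf_rename_tm) (simp add: rename_tm_def)

lemma write_once_rename_tm: "write_once_tm M \<Longrightarrow> write_once_tm (rename_tm M)"
  by (auto simp: write_once_tm_def wf_rename_tm) (auto simp add: rename_tm_def)

lemma step_in_bounds:
  assumes "wf_tm M" "q \<in> states M" "\<And>i. tape i < num_symbols M"
    and "step M (q, h, tape) = (q', h', tape')"
  shows "q' \<in> states M" "tape' i < num_symbols M"
proof -
  have "delta M q (tape h) \<in> states M \<times> {..<num_symbols M} \<times> UNIV"
    using assms unfolding wf_tm_def by blast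
  then show "q' \<in> states M" "tape' i < num_symbols M"
    using assms by (auto split: if_splits prod.splits)
qed

section \<open>Polynomial slowdown\<close>

lemma exp_tower_mono: "x \<le> y \<Longrightarrow> exp_tower k x \<le> exp_tower k y"
  by (induction k) auto

lemma le_exp_tower: "x \<le> exp_tower k x"
proof (induction k)
  case (Suc k)
  then show ?case using less_exp[of "exp_tower k x"] unfolding exp_tower.simps by linarith
qed simp

text \<open>One exponential level absorbs the factor: \<open>r \<le> 2 ^ (r - 1)\<close>, so
  \<open>r * 2 ^ E \<le> 2 ^ (r * E)\<close> for positive \<open>E\<close>, and the factor
  \<open>r\<close> in the exponent is passed down by induction.\<close>

lemma exp_tower_mult:
  assumes "x \<ge> 1" "r \<ge> 1"
  shows "r * exp_tower k x \<le> exp_tower k (r * x)"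
proof (induction k)
  case (Suc k)
  let ?E = "exp_tower k x"
  have E: "?E \<ge> 1" using le_exp_tower[of x k] assms by linarith
  obtain s where r: "r = Suc s" using assms by (cases r) auto
  have "r \<le> 2 ^ s" unfolding r using less_exp[of s] by (simp only: Suc_le_eq)
  also have "\<dots> \<le> 2 ^ (s * ?E)" using E by (intro power_increasing) auto
  finally have "r * 2 ^ ?E \<le> 2 ^ (s * ?E) * 2 ^ ?E" by simp
  also have "\<dots> = 2 ^ (r * ?E)" by (simp add: r flip: power_add)
  also have "\<dots> \<le> 2 ^ exp_tower k (r * x)" using Suc by (intro power_increasing) auto
  finally show ?case by simp
qed simp

text \<open>Above level 0 an \<open>r\<close>-th power multiplies the exponent by \<open>r\<close>;
  this factor moves down to the argument, where \<open>n \<ge> r\<close> trades it for one more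
  factor \<open>n\<close>. That is the origin of \<open>Suc t\<close>.\<close>

lemma exp_tower_power:
  assumes "n \<ge> r" "r \<ge> 1"
  shows "exp_tower k (n ^ t) ^ r \<le> exp_tower k (n ^ (Suc t * r))"
proof (cases k)
  case 0
  have "t * r \<le> Suc t * r" by simp
  with 0 assms show ?thesis by (simp flip: power_mult) (rule power_increasing; simp)
next
  case (Suc j)
  have "r * n ^ t \<le> n ^ Suc t" using assms by simp
  also have "\<dots> \<le> n ^ (Suc t * r)" using assms mult_le_mono2[of 1 r "Suc t"] by (intro power_increasing) auto
  finally have le: "r * n ^ t \<le> n ^ (Suc t * r)" .
  have "r * exp_tower j (n ^ t) \<le> exp_tower j (r * n ^ t)"
    using assms by (intro exp_tower_mult) auto
  also have "\<dots> \<le> exp_tower j (n ^ (Suc t * r))" by (rule exp_tower_mono[OF le])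
  finally show ?thesis unfolding Suc
    by (simp add: mult.commute flip: power_mult)
qed

lemma exp_tower_bounded_poly:
  assumes "exp_tower_bounded k T" "r \<ge> 1" "\<And>n. T' n \<le> D * (n + T n + 1) ^ r"
  shows "exp_tower_bounded k T'"
proof -
  obtain t where "(\<lambda>n. real (T n)) \<in> O(\<lambda>n. real (exp_tower k (n ^ t)))"
    using assms(1) unfolding exp_tower_bounded_def by blast
  then obtain c where c: "eventually (\<lambda>n. real (T n) \<le> c * real (exp_tower k (n ^ t))) at_top"
    by (elim landau_o.bigE) simp
  obtain C where C: "c \<le> real C" using real_arch_simple by blast
  \<comment> \<open>One successor raises \<open>t\<close> so that \<open>n\<close> itself is below
    the tower value \<open>E\<close>; the other is the price of taking the \<open>r\<close>-th
    power.\<close>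
  define s where "s = Suc (Suc t) * r"
  have "eventually (\<lambda>n. real (T' n) \<le> real (D * (C + 2) ^ r) * real (exp_tower k (n ^ s))) at_top"
    using c eventually_ge_at_top[of r]
  proof eventually_elim
    case (elim n)
    define E where "E = exp_tower k (n ^ Suc t)"
    have n: "n \<ge> 1" using elim assms(2) by simp
    have "n ^ 1 \<le> n ^ Suc t" using n by (intro power_increasing) auto
    then have nE: "n \<le> E" using le_exp_tower[of "n ^ Suc t" k] unfolding E_def power_one_right by linarith
    have "real (T n) \<le> real C * real (exp_tower k (n ^ t))"
      using elim(1) C by (meson mult_right_mono of_nat_0_le_iff order_trans)
    also have "\<dots> \<le> real C * real E" unfolding E_def
      using n by (intro mult_left_mono of_nat_mono exp_tower_mono power_increasing) auto
    finally have "T n \<le> C * E" by (metis of_nat_le_iff of_nat_mult)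
    \<comment> \<open>\<open>C\<close> copies of \<open>E\<close> pay for \<open>T n\<close>, one
      for \<open>n\<close> and one for the summand 1.\<close>
    then have "n + T n + 1 \<le> (C + 2) * E" using nE n by simp
    then have "(n + T n + 1) ^ r \<le> (C + 2) ^ r * E ^ r"
      by (metis power_mono zero_le power_mult_distrib)
    also have "E ^ r \<le> exp_tower k (n ^ s)"
      unfolding E_def s_def using elim assms by (intro exp_tower_power) auto
    finally have "(n + T n + 1) ^ r \<le> (C + 2) ^ r * exp_tower k (n ^ s)" by simp
    then have "T' n \<le> D * ((C + 2) ^ r * exp_tower k (n ^ s))"
      using assms(3)[of n] by (meson le_trans mult_le_mono2)
    then show ?case by (metis mult.assoc of_nat_le_iff of_nat_mult)
  qed
  then have "(\<lambda>n. real (T' n)) \<in> O(\<lambda>n. real (exp_tower k (n ^ s)))"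
    by (intro bigoI[where c = "real (D * (C + 2) ^ r)"]) simp
  then show ?thesis unfolding exp_tower_bounded_def by blast
qed

section \<open>From write-once machines to ordinary machines\<close>

definition tape_of :: "nat list \<Rightarrow> nat \<Rightarrow> nat" where
  "tape_of u i = (if i < length u then u ! i else 0)"

lemma tape_of_simps [simp]:
  "tape_of [] i = 0" "tape_of (x # u) 0 = x" "tape_of (x # u) (Suc i) = tape_of u i"
  by (auto simp: tape_of_def)

lemma init_config_eq: "init_config M u = (start M, 0, tape_of u)"
  by (simp add: init_config_def tape_of_def[abs_def])

text \<open>This is where the two input codings meet: 01 and 10 are the binary forms of the letters
  1 and 2, and 00 that of the blank. Both simulations start from this identity and need no phase
  that translates the input.\<close>

lemma tape_of_input_wotm:
  "tape_of (input_wotm w) j =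
   (if even j then tape_of (input_tm w) (j div 2) div 2 else tape_of (input_tm w) (j div 2) mod 2)"
proof (induction w arbitrary: j)
  case Nil
  then show ?case by (simp add: input_wotm_def input_tm_def)
next
  case (Cons b w)
  have w: "input_wotm (b # w) = (if b then [1, 0] else [0, 1]) @ input_wotm w"
    "input_tm (b # w) = (if b then 2 else 1) # input_tm w"
    by (simp_all add: input_wotm_def input_tm_def)
  consider "j = 0" | "j = 1" | i where "j = Suc (Suc i)"
    by (metis One_nat_def not0_implies_Suc)
  then show ?case by cases (simp_all add: w Cons)
qed

lemma tape_of_input_tm_less: "tape_of (input_tm w) i < 3"
proof -
  have "x \<in> set (input_tm w) \<Longrightarrow> x < 3" for x
    by (auto simp: input_tm_def)
  then show ?thesis by (simp add: tape_of_def)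
qed

text \<open>
  Cell \<open>i\<close> of \<open>pair_tm M\<close> holds the cells \<open>2 * i\<close> and \<open>2 * i + 1\<close> of \<open>M\<close> as a two-bit number, so
  that the inputs agree. The value 4 is added in cell 0, because the head can otherwise not tell
  that a move to the left from an even cell of \<open>M\<close> has no effect.
\<close>

definition pair_state :: "'q tm \<Rightarrow> 'q \<Rightarrow> bool \<Rightarrow> ('q \<times> bool) option" where
  "pair_state M q p = Some (q, p \<and> q \<noteq> accept M \<and> q \<noteq> reject M)"

text \<open>The state \<open>None\<close> serves the first step only, which puts the flag 4 into
  cell 0. All later writes keep the flag, as they replace a single bit. \<open>pair_state\<close>
  forgets the half at a halting state of \<open>M\<close>, because only one accepting and one
  rejecting state are available.\<close>

fun pair_delta :: "'q tm \<Rightarrow> ('q \<times> bool) option \<Rightarrow> nat \<Rightarrow> ('q \<times> bool) option \<times> nat \<times> dir" where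
  "pair_delta M None a = (pair_state M (start M) False, a mod 4 + 4, Stay)"
| "pair_delta M (Some (q, p)) a =
     (let (q', b, d) = delta M q (if p then a mod 2 else a div 2 mod 2);
          a' = (if p then 2 * (a div 2) + b else 4 * (a div 4) + 2 * b + a mod 2);
          (p', d') = (case d of Stay \<Rightarrow> (p, Stay)
             | GoRight \<Rightarrow> if p then (False, GoRight) else (True, Stay)
             | GoLeft \<Rightarrow> if p \<or> a \<ge> 4 then (False, Stay) else (True, GoLeft))
      in (pair_state M q' p', a', d'))"

definition pair_tm :: "'q tm \<Rightarrow> ('q \<times> bool) option tm" where
  "pair_tm M = \<lparr>states = insert None (Some ` (states M \<times> UNIV)), num_symbols = 8,
     start = None, accept = pair_state M (accept M) False, reject = pair_state M (reject M) False,
     delta = pair_delta M\<rparr>"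

lemma ordinary_pair_tm:
  assumes "wf_tm M" "num_symbols M = 2"
  shows "ordinary_tm (pair_tm M)"
proof -
  have "pair_delta M s a \<in> insert None (Some ` (states M \<times> UNIV)) \<times> {..<8} \<times> UNIV"
    if s: "s \<in> insert None (Some ` (states M \<times> UNIV))" and a: "a < 8" for s a
  proof (cases s)
    case None
    then show ?thesis using assms by (auto simp: pair_state_def wf_tm_def)
  next
    case (Some c)
    then obtain q p where c: "s = Some (q, p)" and q: "q \<in> states M"
      using s by auto
    obtain q' b d where d: "delta M q (if p then a mod 2 else a div 2 mod 2) = (q', b, d)"
      by (metis prod_cases3)
    have "delta M q x \<in> states M \<times> {..<2} \<times> UNIV" if "x < 2" for x
      using q assms that unfolding wf_tm_def by metis
    from this[of "if p then a mod 2 else a div 2 mod 2"] have "q' \<in> states M" "b < 2"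
      using d by simp_all
    moreover have "2 * (a div 2) + b < 8" "4 * (a div 4) + 2 * b + a mod 2 < 8"
      using a \<open>b < 2\<close> by presburger+
    ultimately show ?thesis using c d
      by (auto simp: pair_state_def split: dir.splits)
  qed
  then show ?thesis
    using assms by (auto simp: ordinary_tm_def wf_tm_def pair_tm_def pair_state_def)
qed

fun pair_sim :: "'q tm \<Rightarrow> 'q config \<Rightarrow> ('q \<times> bool) option config \<Rightarrow> bool" where
  "pair_sim M (q, h, tape) (s, h', tape') \<longleftrightarrow>
     s = pair_state M q (odd h) \<and>
     (q \<noteq> accept M \<longrightarrow> q \<noteq> reject M \<longrightarrow> h' = h div 2 \<and>
        tape' = (\<lambda>i. (if i = 0 then 4 else 0) + 2 * tape (2 * i) + tape (2 * i + 1)))"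

lemma pair_sim_step:
  assumes "wf_tm M" "num_symbols M = 2" "q \<in> states M" "\<And>i. tape i < 2"
    and sim: "pair_sim M (q, h, tape) c'"
  shows "pair_sim M (step M (q, h, tape)) (step (pair_tm M) c')"
proof (cases "q = accept M \<or> q = reject M")
  case True
  with sim show ?thesis by (cases c') (auto simp: pair_tm_def pair_state_def)
next
  case False
  define tape' where "tape' = (\<lambda>i. (if i = 0 then 4 else 0) + 2 * tape (2 * i) + tape (2 * i + 1))"
  have c': "c' = (Some (q, odd h), h div 2, tape')"
    using False sim by (cases c') (auto simp: pair_state_def tape'_def)
  obtain q' b d where d: "delta M q (tape h) = (q', b, d)" by (metis prod_cases3)
  have "tape h < 2" using assms by blast
  then have "delta M q (tape h) \<in> states M \<times> {..<2} \<times> UNIV"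
    using assms(1-3) unfolding wf_tm_def by metis
  then have b: "b < 2" using d by auto
  have t: "tape (2 * i) < 2" "tape (Suc (2 * i)) < 2" for i using assms by auto
  obtain j where j: "h = 2 * j \<or> h = 2 * j + 1" by (metis oddE evenE)
  have rd: "(if odd h then tape' (h div 2) mod 2 else tape' (h div 2) div 2 mod 2) = tape h"
    using j t[of j] unfolding tape'_def by (auto simp: less_2_cases_iff)
  have wr: "tape'(h div 2 := if odd h then 2 * (tape' (h div 2) div 2) + b
       else 4 * (tape' (h div 2) div 4) + 2 * b + tape' (h div 2) mod 2) =
     (\<lambda>i. (if i = 0 then 4 else 0) + 2 * (tape(h := b)) (2 * i) + (tape(h := b)) (2 * i + 1))"
  proof
    fix i
    show "(tape'(h div 2 := if odd h then 2 * (tape' (h div 2) div 2) + b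
       else 4 * (tape' (h div 2) div 4) + 2 * b + tape' (h div 2) mod 2)) i =
     (if i = 0 then 4 else 0) + 2 * (tape(h := b)) (2 * i) + (tape(h := b)) (2 * i + 1)"
    proof (cases "i = j")
      case True
      with j show ?thesis using t[of j] b unfolding tape'_def by (auto simp: less_2_cases_iff)
    next
      case False
      with j have "2 * i \<noteq> h" "2 * i + 1 \<noteq> h" "h div 2 \<noteq> i" by presburger+
      then show ?thesis by (simp add: tape'_def)
    qed
  qed
  \<comment> \<open>A pair without flag is at most 3, so at an even cell the test
    \<open>\<ge> 4\<close> detects exactly cell 0 of \<open>M\<close>.\<close>
  have ge: "even h \<Longrightarrow> tape' (h div 2) \<ge> 4 \<longleftrightarrow> h = 0"
    using j t[of j] unfolding tape'_def by auto
  have nh: "Some (q, odd h) \<noteq> accept (pair_tm M)" "Some (q, odd h) \<noteq> reject (pair_tm M)"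
    using False by (auto simp: pair_tm_def pair_state_def)
  define p' where "p' = odd (move_head d h)"
  define d' where "d' = (case d of Stay \<Rightarrow> Stay | GoRight \<Rightarrow> if odd h then GoRight else Stay
     | GoLeft \<Rightarrow> if odd h \<or> h = 0 then Stay else GoLeft)"
  have pd: "(case d of Stay \<Rightarrow> (odd h, Stay)
             | GoRight \<Rightarrow> if odd h then (False, GoRight) else (True, Stay)
             | GoLeft \<Rightarrow> if odd h \<or> tape' (h div 2) \<ge> 4 then (False, Stay) else (True, GoLeft)) = (p', d')"
    using ge by (cases d) (auto simp: p'_def d'_def)
  have mh: "move_head d' (h div 2) = move_head d h div 2"
    using j by (cases d) (auto simp: d'_def)
  have "pair_delta M (Some (q, odd h)) (tape' (h div 2)) =
     (pair_state M q' p', if odd h then 2 * (tape' (h div 2) div 2) + b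
       else 4 * (tape' (h div 2) div 4) + 2 * b + tape' (h div 2) mod 2, d')"
    unfolding pair_delta.simps rd d Let_def prod.case pd ..
  then have "step (pair_tm M) c' = (pair_state M q' p', move_head d h div 2,
      \<lambda>i. (if i = 0 then 4 else 0) + 2 * (tape(h := b)) (2 * i) + (tape(h := b)) (2 * i + 1))"
    using step_delta[OF _ nh] unfolding c' wr[symmetric] mh[symmetric]
    by (simp add: pair_tm_def)
  moreover have "step M (q, h, tape) = (q', move_head d h, tape(h := b))"
    using False d by simp
  ultimately show ?thesis by (simp add: p'_def)
qed

lemma pair_sim_halt:
  assumes "pair_sim M c c'"
  shows "fst c = accept M \<Longrightarrow> fst c' = accept (pair_tm M)"
    and "fst c = reject M \<Longrightarrow> fst c' = reject (pair_tm M)"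
  using assms by (cases c; cases c'; simp add: pair_tm_def pair_state_def)+

text \<open>The additional step of \<open>pair_tm M\<close> is the one that plants the flag. The
  induction also carries the bounds on states and symbols, without which \<open>delta M\<close> is
  not controlled.\<close>

lemma pair_sim_steps:
  assumes M: "wf_tm M" "num_symbols M = 2"
  shows "pair_sim M ((step M ^^ m) (init_config M (input_wotm w)))
    ((step (pair_tm M) ^^ Suc m) (init_config (pair_tm M) (input_tm w)))"
proof -
  define c where "c m = (step M ^^ m) (init_config M (input_wotm w))" for m
  define c' where "c' m = (step (pair_tm M) ^^ m) (init_config (pair_tm M) (input_tm w))" for m
  have "fst (c m) \<in> states M \<and> (\<forall>i. snd (snd (c m)) i < 2) \<and> pair_sim M (c m) (c' (Suc m))"
  proof (induction m)
    case 0
    let ?t = "tape_of (input_wotm w)" and ?a = "tape_of (input_tm w)"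
    have "?t i < 2" for i
      using tape_of_input_tm_less[of w "i div 2"] by (auto simp: tape_of_input_wotm)
    moreover have "?a i = 2 * ?t (2 * i) + ?t (2 * i + 1)" for i
      by (simp add: tape_of_input_wotm)
    moreover have "(2 * ?t 0 + ?t (Suc 0)) mod 4 = 2 * ?t 0 + ?t (Suc 0)"
      using tape_of_input_tm_less[of w 0] by (simp add: tape_of_input_wotm)
    ultimately show ?case
      using M(1) by (auto simp: c_def c'_def init_config_eq pair_tm_def pair_state_def wf_tm_def fun_eq_iff)
  next
    case (Suc m)
    obtain q h tape where cm: "c m = (q, h, tape)" by (metis prod_cases3)
    obtain q' h' tape' where cS: "step M (q, h, tape) = (q', h', tape')" by (metis prod_cases3)
    have S: "c (Suc m) = step M (c m)" "c' (Suc (Suc m)) = step (pair_tm M) (c' (Suc m))"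
      by (simp_all add: c_def c'_def)
    show ?case unfolding S
      using pair_sim_step[OF M, of q tape h] step_in_bounds[OF M(1) _ _ cS] Suc M
      by (simp add: cm cS del: step.simps)
  qed
  then show ?thesis by (simp add: c_def c'_def del: funpow.simps)
qed

theorem k_DEXPWOTIME_subset: "k_DEXPWOTIME k \<subseteq> k_EXPTIME k"
proof
  fix L assume "L \<in> k_DEXPWOTIME k"
  then obtain M :: "nat tm" and T where M: "write_once_tm M"
    and dec: "decides_in_time M input_wotm L T" and T: "exp_tower_bounded k T"
    unfolding k_DEXPWOTIME_def by blast
  have wf: "wf_tm M" "num_symbols M = 2" using M by (auto simp: write_once_tm_def)
  have "decides_in_time (pair_tm M) input_tm L (\<lambda>n. Suc (T n))"
  proof (rule decides_in_timeI[OF _ dec])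
    fix w m c
    assume m: "m \<le> T (length w)" and c: "(step M ^^ m) (init_config M (input_wotm w)) = c"
    define c' where "c' = (step (pair_tm M) ^^ Suc m) (init_config (pair_tm M) (input_tm w))"
    have "pair_sim M c c'"
      using pair_sim_steps[OF wf, of m w] unfolding c c'_def .
    then show "\<exists>m' \<le> Suc (T (length w)). \<exists>c'.
        (step (pair_tm M) ^^ m') (init_config (pair_tm M) (input_tm w)) = c' \<and>
        (fst c = accept M \<longrightarrow> fst c' = accept (pair_tm M)) \<and>
        (fst c = reject M \<longrightarrow> fst c' = reject (pair_tm M))"
      using m pair_sim_halt c'_def by (metis Suc_le_mono)
  qed
  moreover have "exp_tower_bounded k (\<lambda>n. Suc (T n))"
    by (rule exp_tower_bounded_poly[OF T, of 1 _ 1]) auto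
  ultimately show "L \<in> k_EXPTIME k"
    unfolding k_EXPTIME_def
    using ordinary_rename_tm[OF ordinary_pair_tm[OF wf]] decides_rename_tm by blast
qed

section \<open>Two cells for a symbol of a monotone four-symbol machine\<close>

text \<open>
  The symbol 3 stands for a used cell. In two-bit binary, no allowed write clears a bit.
\<close>

definition monotone4_tm :: "'q tm \<Rightarrow> bool" where
  "monotone4_tm M \<longleftrightarrow> wf_tm M \<and> num_symbols M = 4 \<and>
     (\<forall>q\<in>states M. \<forall>a<4. a = 0 \<or> fst (snd (delta M q a)) \<in> {a, 3})"

datatype 'q block_state = Read 'q | Read2 'q nat | Write 'q nat dir | Move 'q dir

instance dir :: countable by countable_datatype
instance block_state :: (countable) countable by countable_datatype

text \<open>The low bit is written as soon as it is read, so that the head returns to the left cell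
  of the pair; from there two moves in direction \<open>d\<close> reach the neighbouring pair, or
  are both stopped at cell 0. With \<open>max\<close> no mark is erased in any state, even in
  combinations of state and symbol that no run meets.\<close>

fun block_delta :: "'q tm \<Rightarrow> 'q block_state \<Rightarrow> nat \<Rightarrow> 'q block_state \<times> nat \<times> dir" where
  "block_delta M (Read q) x = (Read2 q x, x, GoRight)"
| "block_delta M (Read2 q x) y =
     (let (q', a, d) = delta M q (2 * x + y) in (Write q' (a div 2) d, max y (a mod 2), GoLeft))"
| "block_delta M (Write q b d) x = (Move q d, max x b, d)"
| "block_delta M (Move q d) x = (Read q, x, d)"

definition block_tm :: "'q tm \<Rightarrow> 'q block_state tm" where
  "block_tm M = \<lparr>states = Read ` states M \<union> (\<lambda>(q, x). Read2 q x) ` (states M \<times> {..<2}) \<union>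
       (\<lambda>(q, b, d). Write q b d) ` (states M \<times> {..<2} \<times> {GoLeft, Stay, GoRight}) \<union>
       (\<lambda>(q, d). Move q d) ` (states M \<times> {GoLeft, Stay, GoRight}),
     num_symbols = 2, start = Read (start M), accept = Read (accept M), reject = Read (reject M),
     delta = block_delta M\<rparr>"

lemma dir_UNIV: "d \<in> {GoLeft, Stay, GoRight}"
  by (cases d) auto

lemma write_once_block_tm:
  assumes "monotone4_tm M"
  shows "write_once_tm (block_tm M)"
proof -
  have M: "wf_tm M" "num_symbols M = 4" using assms by (auto simp: monotone4_tm_def)
  let ?S = "states (block_tm M)"
  have delta: "block_delta M s x \<in> ?S \<times> {..<2} \<times> UNIV \<and> (x = 1 \<longrightarrow> fst (snd (block_delta M s x)) = 1)"
    if s: "s \<in> ?S" and x: "x < 2" for s x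
  proof -
    consider q where "s = Read q" "q \<in> states M"
      | q y where "s = Read2 q y" "q \<in> states M" "y < 2"
      | q b d where "s = Write q b d" "q \<in> states M" "b < 2"
      | q d where "s = Move q d" "q \<in> states M"
      using s by (auto simp: block_tm_def)
    then show ?thesis
    proof cases
      case (2 q y)
      obtain q' a d where d: "delta M q (2 * y + x) = (q', a, d)" by (metis prod_cases3)
      have "2 * y + x < 4" using 2 x by simp
      then have "delta M q (2 * y + x) \<in> states M \<times> {..<4} \<times> UNIV"
        using M 2 unfolding wf_tm_def by metis
      with d have "q' \<in> states M" "a div 2 < 2" by auto
      then show ?thesis using 2 x d dir_UNIV by (auto simp: block_tm_def image_iff)
    qed (use x dir_UNIV in \<open>auto simp: block_tm_def image_iff\<close>)
  qed
  have "finite ?S" "{start (block_tm M), accept (block_tm M), reject (block_tm M)} \<subseteq> ?S"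
    "accept (block_tm M) \<noteq> reject (block_tm M)"
    using M by (auto simp: block_tm_def wf_tm_def)
  moreover have "num_symbols (block_tm M) = 2" "delta (block_tm M) = block_delta M"
    by (simp_all add: block_tm_def)
  ultimately show ?thesis
    using delta unfolding write_once_tm_def wf_tm_def by (metis one_less_numeral_iff semiring_norm(76))
qed

definition expand :: "(nat \<Rightarrow> nat) \<Rightarrow> nat \<Rightarrow> nat" where
  "expand tape j = (if even j then tape (j div 2) div 2 else tape (j div 2) mod 2)"

lemma block_step:
  assumes M: "monotone4_tm M" and q: "q \<in> states M" and tape: "\<And>i. tape i < 4"
    and step: "step M (q, h, tape) = (q', h', tape')"
  shows "(step (block_tm M) ^^ 4) (Read q, 2 * h, expand tape) = (Read q', 2 * h', expand tape')"
proof (cases "q = accept M \<or> q = reject M")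
  case True
  then have "step (block_tm M) (Read q, 2 * h, expand tape) = (Read q, 2 * h, expand tape)"
    by (auto simp: block_tm_def)
  then have "(step (block_tm M) ^^ m) (Read q, 2 * h, expand tape) = (Read q, 2 * h, expand tape)" for m
    by (induction m) (simp_all del: step.simps)
  with True step show ?thesis by auto
next
  case False
  obtain p a d where d: "delta M q (tape h) = (p, a, d)" by (metis prod_cases3)
  have S: "q' = p" "h' = move_head d h" "tape' = tape(h := a)"
    using step step_delta[of M q tape h, OF d] False by auto
  have wf: "wf_tm M" "num_symbols M = 4" using M by (auto simp: monotone4_tm_def)
  have th: "tape h < 4" using tape .
  then have "delta M q (tape h) \<in> states M \<times> {..<4} \<times> UNIV"
    using wf q unfolding wf_tm_def by metis
  then have a: "a < 4" using d by simp
  have "tape h = 0 \<or> a \<in> {tape h, 3}"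
    using M q th d unfolding monotone4_tm_def by (metis fst_conv snd_conv)
  \<comment> \<open>Bitwise, a permitted new symbol dominates the old one, so here
    \<open>max\<close> writes exactly the intended bits.\<close>
  then have mono: "max (tape h div 2) (a div 2) = a div 2" "max (tape h mod 2) (a mod 2) = a mod 2"
    using th by auto
  have nh: "s \<noteq> accept (block_tm M)" "s \<noteq> reject (block_tm M)" if "s \<noteq> Read (accept M)" "s \<noteq> Read (reject M)" for s
    using that by (auto simp: block_tm_def)
  have delta: "delta (block_tm M) = block_delta M" by (simp add: block_tm_def)
  let ?x = "tape h div 2" and ?t = "expand tape"
  let ?t1 = "?t(2 * h + 1 := a mod 2)"
  let ?t2 = "?t1(2 * h := a div 2)"
  have x: "?t (2 * h) = ?x" and y: "?t (2 * h + 1) = tape h mod 2" by (simp_all add: expand_def)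
  have t2: "?t2 = expand (tape(h := a))"
    by (auto simp: expand_def fun_eq_iff elim!: evenE oddE)
  have 1: "step (block_tm M) (Read q, 2 * h, ?t) = (Read2 q ?x, 2 * h + 1, ?t)"
    using step_delta[of "block_tm M" "Read q" ?t "2 * h" "Read2 q ?x" ?x GoRight] nh[of "Read q"] False x
    by (auto simp: delta x)
  have "2 * ?x + tape h mod 2 = tape h" by simp
  then have 2: "step (block_tm M) (Read2 q ?x, 2 * h + 1, ?t) = (Write p (a div 2) d, 2 * h, ?t1)"
    using step_delta[of "block_tm M" "Read2 q ?x" ?t "2 * h + 1" "Write p (a div 2) d" "a mod 2" GoLeft]
      nh[of "Read2 q ?x"] y d mono by (simp add: delta)
  have 3: "step (block_tm M) (Write p (a div 2) d, 2 * h, ?t1) = (Move p d, move_head d (2 * h), ?t2)"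
    using step_delta[of "block_tm M" "Write p (a div 2) d" ?t1 "2 * h" "Move p d" "a div 2" d]
      nh[of "Write p (a div 2) d"] x mono by (simp add: delta)
  have 4: "step (block_tm M) (Move p d, move_head d (2 * h), ?t2) =
      (Read p, move_head d (move_head d (2 * h)), ?t2)"
    using step_delta[of "block_tm M" "Move p d" ?t2 "move_head d (2 * h)" "Read p" _ d]
      nh[of "Move p d"] by (simp add: delta fun_upd_idem del: fun_upd_apply)
  have "move_head d (move_head d (2 * h)) = 2 * move_head d h" by (cases d) auto
  moreover have "(4 :: nat) = Suc (Suc (Suc (Suc 0)))" by simp
  ultimately show ?thesis
    unfolding S t2[symmetric] by (simp only: funpow.simps comp_apply id_apply 1 2 3 4)
qed

lemma block_steps:
  assumes M: "monotone4_tm M"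
    and m: "(step M ^^ m) (init_config M (input_tm w)) = (q, h, tape)"
  shows "(step (block_tm M) ^^ (4 * m)) (init_config (block_tm M) (input_wotm w)) =
      (Read q, 2 * h, expand tape)"
proof -
  have wf: "wf_tm M" "num_symbols M = 4" using M by (auto simp: monotone4_tm_def)
  have "q \<in> states M \<and> (\<forall>i. tape i < 4) \<and>
    (step (block_tm M) ^^ (4 * m)) (init_config (block_tm M) (input_wotm w)) =
      (Read q, 2 * h, expand tape)"
    using m
  proof (induction m arbitrary: q h tape)
    case 0
    have "tape_of (input_wotm w) = expand (tape_of (input_tm w))"
      by (simp add: fun_eq_iff tape_of_input_wotm expand_def)
    moreover have "tape_of (input_tm w) i < 4" for i
      using tape_of_input_tm_less[of w i] by simp
    ultimately show ?case
      using 0 wf by (auto simp: init_config_eq block_tm_def wf_tm_def)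
  next
    case (Suc m)
    obtain q1 h1 t1 where c1: "(step M ^^ m) (init_config M (input_tm w)) = (q1, h1, t1)"
      by (metis prod_cases3)
    have s: "step M (q1, h1, t1) = (q, h, tape)"
      using Suc.prems c1 by (simp del: step.simps)
    have IH: "q1 \<in> states M" "\<And>i. t1 i < 4"
      and B: "(step (block_tm M) ^^ (4 * m)) (init_config (block_tm M) (input_wotm w)) =
        (Read q1, 2 * h1, expand t1)"
      using Suc.IH[OF c1] by auto
    have "4 * Suc m = 4 + 4 * m" by simp
    then have "(step (block_tm M) ^^ (4 * Suc m)) (init_config (block_tm M) (input_wotm w)) =
        (step (block_tm M) ^^ 4) (Read q1, 2 * h1, expand t1)"
      by (simp only: funpow_add comp_apply B)
    then show ?case
      using block_step[OF M IH s] step_in_bounds[OF wf(1) IH(1) _ s] IH(2) wf(2) by simp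
  qed
  then show ?thesis by blast
qed

section \<open>Passes over a string on a monotone tape\<close>

definition runs :: "'q tm \<Rightarrow> nat \<Rightarrow> 'q config \<Rightarrow> 'q config \<Rightarrow> bool" where
  "runs M n c c' \<longleftrightarrow> (\<exists>m\<le>n. (step M ^^ m) c = c')"

lemma runs_refl: "runs M n c c"
  unfolding runs_def by (intro exI[of _ 0]) simp

lemma runs_trans:
  assumes "runs M m c c'" "runs M n c' c''" "m + n \<le> k"
  shows "runs M k c c''"
proof -
  obtain i j where "i \<le> m" "(step M ^^ i) c = c'" "j \<le> n" "(step M ^^ j) c' = c''"
    using assms unfolding runs_def by blast
  then show ?thesis
    using assms(3) unfolding runs_def by (intro exI[of _ "j + i"]) (simp add: funpow_add)
qed

lemma runs_step:
  assumes "delta M q (tape h) = (q', a, d)" "q \<noteq> accept M" "q \<noteq> reject M"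
    and "h' = move_head d h" "tape' = tape(h := a)" "n \<ge> 1"
  shows "runs M n (q, h, tape) (q', h', tape')"
  using step_delta[of M q tape h q' a d] assms unfolding runs_def
  by (intro exI[of _ 1]) (simp del: step.simps)

lemma tape_of_append [simp]:
  "tape_of (xs @ y # ys) (length xs) = y" "tape_of xs (length xs) = 0"
  by (simp_all add: tape_of_def)

lemma tape_of_upd:
  "(tape_of (xs @ y # ys))(length xs := z) = tape_of (xs @ z # ys)"
  "(tape_of xs)(length xs := z) = tape_of (xs @ [z])"
  by (auto simp: tape_of_def fun_eq_iff nth_append nth_Cons split: nat.splits)

lemma runs_scan_right:
  assumes "\<And>x. x \<in> set v \<Longrightarrow> delta M s x = (s, x, GoRight)" "s \<noteq> accept M" "s \<noteq> reject M"
    and "l = xs @ v @ ys" "h = length xs" "h' = length xs + length v"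
  shows "runs M (length v) (s, h, tape_of l) (s, h', tape_of l)"
  using assms
proof (induction v arbitrary: xs h)
  case Nil
  then show ?case by (simp add: runs_refl)
next
  case (Cons x v)
  have "runs M 1 (s, h, tape_of l) (s, Suc h, tape_of l)"
    using Cons.prems by (intro runs_step[where a = x and d = GoRight]) (auto simp: tape_of_upd)
  moreover have "runs M (length v) (s, Suc h, tape_of l) (s, h', tape_of l)"
    using Cons.prems by (intro Cons.IH[of "xs @ [x]"]) auto
  ultimately show ?case by (rule runs_trans) simp
qed

text \<open>The head starts on the last letter of \<open>v\<close> and stops on the delimiter
  \<open>y\<close>; since \<open>y\<close> precedes \<open>v\<close>, no left move is cut off at
  cell 0.\<close>

lemma runs_scan_left:
  assumes "\<And>x. x \<in> set v \<Longrightarrow> delta M s x = (s, x, GoLeft)" "s \<noteq> accept M" "s \<noteq> reject M"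
    and "l = xs @ y # v @ ys" "h = length xs + length v" "h' = length xs"
  shows "runs M (length v) (s, h, tape_of l) (s, h', tape_of l)"
  using assms
proof (induction v arbitrary: ys h rule: rev_induct)
  case Nil
  then show ?case by (simp add: runs_refl)
next
  case (snoc x v)
  have l: "l = (xs @ y # v) @ x # ys" and h: "h = length (xs @ y # v)" using snoc.prems by auto
  have "runs M 1 (s, h, tape_of l) (s, h - 1, tape_of l)"
    using snoc.prems(1-3) unfolding l h
    by (intro runs_step[where a = x and d = GoLeft]) (simp_all only: tape_of_append tape_of_upd, auto)
  moreover have "runs M (length v) (s, h - 1, tape_of l) (s, h', tape_of l)"
    using snoc.prems by (intro snoc.IH[of "x # ys"]) auto
  ultimately show ?case by (rule runs_trans) simp
qed

text \<open>
  A pass machine rewrites a string over the letters 1 and 2 in successive passes: \<open>out\<close> handles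
  a letter and \<open>fin\<close> the end of a pass, both giving a new state and a piece of the new string.
\<close>

locale pass_machine =
  fixes Q :: "'p set" and q0 acc rej :: 'p and K :: nat
    and out :: "'p \<Rightarrow> nat \<Rightarrow> 'p \<times> nat list" and fin :: "'p \<Rightarrow> 'p \<times> nat list"
  assumes finite_Q: "finite Q"
    and states_Q: "q0 \<in> Q - {acc, rej}" "acc \<in> Q" "rej \<in> Q" "acc \<noteq> rej"
    and out: "q \<in> Q \<Longrightarrow> b \<in> {1, 2} \<Longrightarrow>
      out q b \<in> (Q - {acc, rej}) \<times> {u. set u \<subseteq> {1, 2} \<and> length u \<le> K}"
    and fin: "q \<in> Q \<Longrightarrow> fin q \<in> Q \<times> {u. set u \<subseteq> {1, 2} \<and> length u \<le> K}"

type_synonym 'p pass_config = "'p \<times> nat list \<times> nat list"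

context pass_machine
begin

fun pass_step :: "'p pass_config \<Rightarrow> 'p pass_config" where
  "pass_step (q, w, u) =
     (if q = acc \<or> q = rej then (q, w, u)
      else case w of
        [] \<Rightarrow> let (q', v) = fin q in (q', u @ v, [])
      | b # w' \<Rightarrow> let (q', v) = out q b in (q', w', u @ v))"

definition proper :: "'p pass_config \<Rightarrow> bool" where
  "proper c \<longleftrightarrow> (case c of (q, w, u) \<Rightarrow> q \<in> Q \<and> set w \<subseteq> {1, 2} \<and> set u \<subseteq> {1, 2})"

lemma pass_step_proper: "proper c \<Longrightarrow> proper (pass_step c)"
proof (cases c)
  case (fields q w u)
  assume "proper c"
  then show ?thesis
    using out[of q "hd w"] fin[of q]
    by (cases w) (auto simp: fields proper_def split: prod.splits)
qed

end

text \<open>The constructors follow the round trip for one letter: \<open>Fetch\<close> reads it,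
  \<open>Pass1\<close> crosses the rest of the old string up to the separator, \<open>Pass2\<close>
  crosses the new string up to the first blank, \<open>Emit\<close> appends the output carried in
  its list, \<open>Back1\<close> returns to the separator and \<open>Back2\<close> to the last used
  cell before the old string.\<close>

datatype 'p scan_state =
  Begin | Pass1 'p "nat list" | Pass2 'p "nat list" | Emit 'p "nat list" | Back1 'p | Back2 'p | Fetch 'p

instance scan_state :: (countable) countable by countable_datatype

context pass_machine
begin

text \<open>
  During a pass the tape is a nonempty block of used cells, the unread part of the old string, a
  single used cell as separator, and the new string. The symbol 3 thus has two roles, and the
  head finds the next letter by going left past the separator to the second 3. The left end of
  the tape is not visible either, so the first letter is handled separately, which makes the
  first block nonempty.
\<close>

fun scan_delta :: "'p scan_state \<Rightarrow> nat \<Rightarrow> 'p scan_state \<times> nat \<times> dir" where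
  "scan_delta Begin a =
     (if a = 1 \<or> a = 2 then let (q', v) = out q0 a in (Pass2 q' (3 # v), 3, GoRight)
      else (Pass2 q0 [3], 3, GoRight))"
| "scan_delta (Pass1 q v) a = (if a = 3 then Pass2 q v else Pass1 q v, a, GoRight)"
| "scan_delta (Pass2 q v) a = (if a = 0 then (Emit q v, a, Stay) else (Pass2 q v, a, GoRight))"
| "scan_delta (Emit q []) a = (Back1 q, a, GoLeft)"
| "scan_delta (Emit q (x # v)) a = (Emit q v, if a = 0 then x else a, GoRight)"
| "scan_delta (Back1 q) a = (if a = 3 then Back2 q else Back1 q, a, GoLeft)"
| "scan_delta (Back2 q) a = (if a = 3 then (Fetch q, a, GoRight) else (Back2 q, a, GoLeft))"
| "scan_delta (Fetch q) a =
     (if a = 1 \<or> a = 2 then let (q', v) = out q a in (Pass1 q' v, 3, GoRight)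
      else let (q', v) = fin q in (Pass2 q' (v @ [3]), a, GoRight))"

text \<open>The symbol 3 and the length \<open>Suc K\<close> allow for a separator that is written
  together with a piece of output.\<close>

definition scan_words :: "nat list set" where
  "scan_words = {v. set v \<subseteq> {1, 2, 3} \<and> length v \<le> Suc K}"

definition scan_tm :: "'p scan_state tm" where
  "scan_tm = \<lparr>states = {Begin} \<union> (\<lambda>(q, v). Pass1 q v) ` (Q \<times> scan_words) \<union>
       (\<lambda>(q, v). Pass2 q v) ` (Q \<times> scan_words) \<union> (\<lambda>(q, v). Emit q v) ` (Q \<times> scan_words) \<union>
       Back1 ` Q \<union> Back2 ` Q \<union> Fetch ` Q,
     num_symbols = 4, start = Begin, accept = Emit acc [], reject = Emit rej [],
     delta = scan_delta\<rparr>"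

lemma scan_delta_in:
  assumes s: "s \<in> states scan_tm" and a: "a < 4"
  shows "scan_delta s a \<in> states scan_tm \<times> {..<4} \<times> UNIV"
    "a = 0 \<or> fst (snd (scan_delta s a)) \<in> {a, 3}"
proof -
  have "scan_delta s a \<in> states scan_tm \<times> {..<4} \<times> UNIV \<and>
    (a = 0 \<or> fst (snd (scan_delta s a)) \<in> {a, 3})"
  proof (cases s)
    case Begin
    then show ?thesis using a states_Q out[of q0 a]
      by (auto simp: scan_tm_def scan_words_def image_iff split: prod.splits)
  next
    case (Emit q v)
    then show ?thesis using s a
      by (cases v) (auto simp: scan_tm_def scan_words_def image_iff)
  next
    case (Fetch q)
    then show ?thesis using s a out[of q a] fin[of q]
      by (auto simp: scan_tm_def scan_words_def image_iff split: prod.splits)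
  qed (use s a in \<open>auto simp: scan_tm_def scan_words_def image_iff\<close>)
  then show "scan_delta s a \<in> states scan_tm \<times> {..<4} \<times> UNIV"
    "a = 0 \<or> fst (snd (scan_delta s a)) \<in> {a, 3}" by auto
qed

lemma monotone4_scan_tm: "monotone4_tm scan_tm"
proof -
  have "finite scan_words" unfolding scan_words_def by (rule finite_lists_length_le) simp
  then have "finite (states scan_tm)" using finite_Q by (simp add: scan_tm_def)
  moreover have "{start scan_tm, accept scan_tm, reject scan_tm} \<subseteq> states scan_tm"
    using states_Q by (auto simp: scan_tm_def scan_words_def image_iff)
  moreover have "num_symbols scan_tm = 4" "delta scan_tm = scan_delta" "accept scan_tm \<noteq> reject scan_tm"
    using states_Q by (auto simp: scan_tm_def)
  ultimately show ?thesis
    using scan_delta_in unfolding monotone4_tm_def wf_tm_def by auto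
qed

section \<open>Runs of the scanning machine and their cost\<close>

lemma scan_tm_simps:
  "delta scan_tm = scan_delta" "accept scan_tm = Emit acc []" "reject scan_tm = Emit rej []"
  by (simp_all add: scan_tm_def)

definition scan_string :: "nat \<Rightarrow> nat list \<Rightarrow> nat list \<Rightarrow> nat list" where
  "scan_string a w u = replicate (Suc a) 3 @ w @ 3 # u"

text \<open>The resting point between two pass steps: nothing is left to write and the head is on
  the first blank. For a halting pass state this is a halting configuration of
  \<open>scan_tm\<close>.\<close>

fun scan_config :: "nat \<Rightarrow> 'p pass_config \<Rightarrow> 'p scan_state config" where
  "scan_config a (q, w, u) = (Emit q [], length (scan_string a w u), tape_of (scan_string a w u))"

lemma runs_emit:
  "runs scan_tm (length v) (Emit q v, length l, tape_of l) (Emit q [], length (l @ v), tape_of (l @ v))"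
proof (induction v arbitrary: l)
  case Nil
  then show ?case by (simp add: runs_refl)
next
  case (Cons x v)
  have "runs scan_tm 1 (Emit q (x # v), length l, tape_of l)
      (Emit q v, length (l @ [x]), tape_of (l @ [x]))"
    by (intro runs_step[where a = x and d = GoRight]) (simp_all add: scan_tm_simps tape_of_upd)
  from runs_trans[OF this Cons.IH[of "l @ [x]"]] show ?case by simp
qed

lemma runs_pass2:
  assumes "set u \<subseteq> {1, 2}" "h = length l"
  shows "runs scan_tm (length u + length v + 1) (Pass2 q v, h, tape_of (l @ u))
    (Emit q [], length (l @ u @ v), tape_of (l @ u @ v))"
proof -
  have "runs scan_tm (length u) (Pass2 q v, h, tape_of (l @ u)) (Pass2 q v, length (l @ u), tape_of (l @ u))"
    using assms by (intro runs_scan_right[where ys = "[]" and xs = l]) (auto simp: scan_tm_simps)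
  moreover have "runs scan_tm 1 (Pass2 q v, length (l @ u), tape_of (l @ u))
      (Emit q v, length (l @ u), tape_of (l @ u))"
    by (intro runs_step[where a = 0 and d = Stay])
      (simp_all only: tape_of_append scan_tm_simps, auto simp: fun_eq_iff tape_of_def)
  ultimately have "runs scan_tm (length u + 1) (Pass2 q v, h, tape_of (l @ u))
      (Emit q v, length (l @ u), tape_of (l @ u))"
    by (rule runs_trans) simp
  from runs_trans[OF this runs_emit] show ?thesis by simp
qed

lemma runs_back:
  assumes w: "set w \<subseteq> {1, 2}" and u: "set u \<subseteq> {1, 2}" and q: "q \<noteq> acc" "q \<noteq> rej"
  shows "runs scan_tm (length w + length u + 3) (scan_config a (q, w, u))
    (Fetch q, Suc a, tape_of (scan_string a w u))"
proof -
  let ?l = "scan_string a w u"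
  let ?i = "Suc a + length w"
  \<comment> \<open>The same string is split at its two delimiters: the separator stops
    \<open>Back1\<close>, the last cell of the used block stops \<open>Back2\<close>.\<close>
  have l1: "?l = (replicate (Suc a) 3 @ w) @ 3 # u @ []" and l2: "?l = replicate a 3 @ 3 # w @ 3 # u"
    by (simp_all add: scan_string_def replicate_append_same flip: replicate_append_same)
  have t1: "tape_of ?l ?i = 3" unfolding l1 using tape_of_append(1)[of "replicate (Suc a) 3 @ w"] by simp
  have t2: "tape_of ?l a = 3" unfolding l2 using tape_of_append(1)[of "replicate a 3"] by simp
  have "runs scan_tm 1 (Emit q [], length ?l, tape_of ?l) (Back1 q, ?i + length u, tape_of ?l)"
    using q by (intro runs_step[where d = GoLeft]) (auto simp: scan_tm_simps scan_string_def)
  moreover have "runs scan_tm (length u) (Back1 q, ?i + length u, tape_of ?l) (Back1 q, ?i, tape_of ?l)"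
    using u by (intro runs_scan_left[OF _ _ _ l1]) (auto simp: scan_tm_simps)
  ultimately have "runs scan_tm (1 + length u) (Emit q [], length ?l, tape_of ?l) (Back1 q, ?i, tape_of ?l)"
    by (rule runs_trans) simp
  moreover have "runs scan_tm 1 (Back1 q, ?i, tape_of ?l) (Back2 q, a + length w, tape_of ?l)"
    using t1 by (intro runs_step[where d = GoLeft and a = 3]) (auto simp: scan_tm_simps fun_eq_iff)
  ultimately have "runs scan_tm (2 + length u) (Emit q [], length ?l, tape_of ?l)
      (Back2 q, a + length w, tape_of ?l)"
    by (rule runs_trans) simp
  moreover have "runs scan_tm (length w) (Back2 q, a + length w, tape_of ?l) (Back2 q, a, tape_of ?l)"
    using w by (intro runs_scan_left[OF _ _ _ l2]) (auto simp: scan_tm_simps)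
  ultimately have "runs scan_tm (2 + length u + length w) (Emit q [], length ?l, tape_of ?l)
      (Back2 q, a, tape_of ?l)"
    by (rule runs_trans) simp
  moreover have "runs scan_tm 1 (Back2 q, a, tape_of ?l) (Fetch q, Suc a, tape_of ?l)"
    using t2 by (intro runs_step[where d = GoRight and a = 3]) (auto simp: scan_tm_simps fun_eq_iff)
  ultimately show ?thesis unfolding scan_config.simps by (rule runs_trans) simp
qed

text \<open>The used block grows by one cell whether a letter or the old separator joins it. A
  letter is replaced in place, so the string grows by the output only; the end of a pass adds a new
  separator as well, whence \<open>K + 1\<close>.\<close>

lemma runs_pass_step:
  assumes "proper (q, w, u)"
  shows "\<exists>a'. runs scan_tm (2 * length (scan_string a w u) + K + 10) (scan_config a (q, w, u))
      (scan_config a' (pass_step (q, w, u))) \<and>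
    (case pass_step (q, w, u) of (q', w', u') \<Rightarrow>
      length (scan_string a' w' u') \<le> length (scan_string a w u) + K + 1)"
proof (cases "q = acc \<or> q = rej")
  case True
  then show ?thesis by (intro exI[of _ a]) (auto simp: runs_refl)
next
  case False
  then have q: "q \<in> Q" "q \<noteq> acc" "q \<noteq> rej" and w: "set w \<subseteq> {1, 2}" and u: "set u \<subseteq> {1, 2}"
    using assms by (auto simp: proper_def)
  show ?thesis
  proof (cases w)
    case Nil
    obtain q' v where f: "fin q = (q', v)" by force
    have v: "length v \<le> K" using fin[OF q(1)] f by simp
    let ?l = "scan_string a [] u"
    \<comment> \<open>With no unread letter left, the separator is adjacent to the used block and is
      counted as its last cell; the new string thereby becomes the old one of the next pass.\<close>
    have l: "?l = replicate (Suc (Suc a)) 3 @ u"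
      by (simp add: scan_string_def flip: replicate_append_same)
    have "tape_of ?l (Suc a) = 3"
      unfolding scan_string_def using tape_of_append(1)[of "replicate (Suc a) 3"] by simp
    then have "runs scan_tm 1 (Fetch q, Suc a, tape_of ?l)
        (Pass2 q' (v @ [3]), Suc (Suc a), tape_of ?l)"
      by (intro runs_step[where d = GoRight and a = 3]) (auto simp: scan_tm_simps fun_eq_iff f)
    from runs_trans[OF runs_back[OF _ u q(2,3), of "[]" a] this order.refl]
    have "runs scan_tm (length u + 4) (scan_config a (q, [], u))
        (Pass2 q' (v @ [3]), Suc (Suc a), tape_of ?l)" by (simp add: add.commute)
    moreover have "runs scan_tm (length u + length (v @ [3]) + 1)
        (Pass2 q' (v @ [3]), Suc (Suc a), tape_of ?l) (scan_config (Suc a) (q', u @ v, []))"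
      using runs_pass2[OF u, of "Suc (Suc a)" "replicate (Suc (Suc a)) 3" "v @ [3]" q']
      unfolding l by (simp add: scan_string_def)
    ultimately have "runs scan_tm (2 * length ?l + K + 10) (scan_config a (q, [], u))
        (scan_config (Suc a) (q', u @ v, []))"
      by (rule runs_trans) (use v in \<open>simp add: scan_string_def\<close>)
    then show ?thesis
      using q f v Nil by (intro exI[of _ "Suc a"]) (auto simp: scan_string_def)
  next
    case (Cons b w')
    obtain q' v where o: "out q b = (q', v)" by force
    have b: "b = 1 \<or> b = 2" and w': "set w' \<subseteq> {1, 2}" using w Cons by auto
    have v: "length v \<le> K" using out[OF q(1), of b] b o by auto
    let ?l = "scan_string a (b # w') u" and ?l' = "scan_string (Suc a) w' u"
    have l: "?l = replicate (Suc a) 3 @ b # w' @ 3 # u" by (simp add: scan_string_def)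
    have l': "?l' = replicate (Suc a) 3 @ 3 # w' @ 3 # u" "?l' = (replicate (Suc (Suc a)) 3 @ w') @ 3 # u"
      "?l' = (replicate (Suc (Suc a)) 3 @ w' @ [3]) @ u"
      by (simp_all add: scan_string_def flip: replicate_append_same)
    have "tape_of ?l (Suc a) = b" "(tape_of ?l)(Suc a := 3) = tape_of ?l'"
      unfolding l l'(1) using tape_of_append(1)[of "replicate (Suc a) 3"] tape_of_upd(1)[of "replicate (Suc a) 3"]
      by (simp_all del: replicate.simps)
    then have "runs scan_tm 1 (Fetch q, Suc a, tape_of ?l) (Pass1 q' v, Suc (Suc a), tape_of ?l')"
      using b by (intro runs_step[where d = GoRight and a = 3]) (auto simp: scan_tm_simps o)
    from runs_trans[OF runs_back[OF _ u q(2,3), of "b # w'" a] this order.refl]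
    have "runs scan_tm (length w' + length u + 5) (scan_config a (q, b # w', u))
        (Pass1 q' v, Suc (Suc a), tape_of ?l')" using b w' by (simp add: ac_simps)
    moreover have "runs scan_tm (length w') (Pass1 q' v, Suc (Suc a), tape_of ?l')
        (Pass1 q' v, Suc (Suc a) + length w', tape_of ?l')"
      using w' by (intro runs_scan_right[where xs = "replicate (Suc (Suc a)) 3" and ys = "3 # u"])
        (auto simp: scan_tm_simps l'(2))
    ultimately have "runs scan_tm (2 * length w' + length u + 5) (scan_config a (q, b # w', u))
        (Pass1 q' v, Suc (Suc a) + length w', tape_of ?l')"
      by (rule runs_trans) simp
    moreover have "tape_of ?l' (Suc (Suc a) + length w') = 3"
      unfolding l'(2) using tape_of_append(1)[of "replicate (Suc (Suc a)) 3 @ w'"] by simp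
    then have "runs scan_tm 1 (Pass1 q' v, Suc (Suc a) + length w', tape_of ?l')
        (Pass2 q' v, Suc (Suc (Suc a)) + length w', tape_of ?l')"
      by (intro runs_step[where d = GoRight and a = 3]) (auto simp: scan_tm_simps fun_eq_iff)
    ultimately have "runs scan_tm (2 * length w' + length u + 6) (scan_config a (q, b # w', u))
        (Pass2 q' v, Suc (Suc (Suc a)) + length w', tape_of ?l')"
      by (rule runs_trans) simp
    moreover have "runs scan_tm (length u + length v + 1)
        (Pass2 q' v, Suc (Suc (Suc a)) + length w', tape_of ?l') (scan_config (Suc a) (q', w', u @ v))"
      using runs_pass2[OF u, of "Suc (Suc (Suc a)) + length w'" "replicate (Suc (Suc a)) 3 @ w' @ [3]" v q']
      unfolding l'(3) by (simp add: scan_string_def)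
    ultimately have "runs scan_tm (2 * length ?l + K + 10) (scan_config a (q, b # w', u))
        (scan_config (Suc a) (q', w', u @ v))"
      by (rule runs_trans) (use v in \<open>simp add: scan_string_def\<close>)
    then show ?thesis
      using q o v Cons by (intro exI[of _ "Suc a"]) (auto simp: scan_string_def)
  qed
qed

text \<open>Every step adds at most \<open>K + 1\<close> symbols, so the final length bound serves
  for all \<open>N\<close> round trips, and the total is quadratic in \<open>N\<close>.\<close>

lemma runs_pass_steps:
  assumes "proper (q, w, u)" "length (scan_string a w u) \<le> e"
    and "(pass_step ^^ N) (q, w, u) = c"
  shows "\<exists>a'. runs scan_tm (N * (2 * (e + N * (K + 1)) + K + 10)) (scan_config a (q, w, u)) (scan_config a' c) \<and>
    proper c \<and> (case c of (q', w', u') \<Rightarrow> length (scan_string a' w' u') \<le> e + N * (K + 1))"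
  using assms(3)
proof (induction N arbitrary: c)
  case 0
  then show ?case using assms by (intro exI[of _ a]) (auto simp: runs_refl)
next
  case (Suc N)
  obtain q' w' u' where c: "(pass_step ^^ N) (q, w, u) = (q', w', u')" by (metis prod_cases3)
  obtain a' where r: "runs scan_tm (N * (2 * (e + N * (K + 1)) + K + 10)) (scan_config a (q, w, u))
      (scan_config a' (q', w', u'))" and p: "proper (q', w', u')"
    and l: "length (scan_string a' w' u') \<le> e + N * (K + 1)"
    using Suc.IH[OF c] by auto
  have c': "c = pass_step (q', w', u')" using Suc.prems c by (simp del: pass_step.simps)
  obtain a'' where r': "runs scan_tm (2 * length (scan_string a' w' u') + K + 10)
      (scan_config a' (q', w', u')) (scan_config a'' c)"
    and l': "case c of (q', w'', u'') \<Rightarrow>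
      length (scan_string a'' w'' u'') \<le> length (scan_string a' w' u') + K + 1"
    using runs_pass_step[OF p, of a', folded c'] by (elim exE conjE) (rule that)
  have "N * (2 * (e + N * (K + 1)) + K + 10) \<le> N * (2 * (e + Suc N * (K + 1)) + K + 10)"
    by (intro mult_le_mono) auto
  moreover have "2 * length (scan_string a' w' u') + K + 10 \<le> 2 * (e + Suc N * (K + 1)) + K + 10"
    using l by simp
  ultimately have "N * (2 * (e + N * (K + 1)) + K + 10) + (2 * length (scan_string a' w' u') + K + 10)
      \<le> Suc N * (2 * (e + Suc N * (K + 1)) + K + 10)"
    unfolding mult_Suc[of N] by linarith
  then show ?case
    using runs_trans[OF r r'] pass_step_proper[OF p] l l' unfolding c'[symmetric]
    by (intro exI[of _ a'']) (auto split: prod.splits)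
qed

text \<open>On a nonempty word \<open>Begin\<close> already performs the pass step of the first
  letter, leaving \<open>N\<close> of the \<open>Suc N\<close> steps. On the empty word it only sets
  up a used cell and a separator, and all \<open>Suc N\<close> steps remain; the factor
  \<open>N + 1\<close> covers both cases.\<close>

lemma runs_init:
  assumes w: "set w \<subseteq> {1, 2}"
  shows "\<exists>a. runs scan_tm (length w + K + 3 + (N + 1) * (2 * (length w + K + 2 + (N + 1) * (K + 1)) + K + 10))
    (init_config scan_tm w) (scan_config a ((pass_step ^^ Suc N) (q0, w, [])))"
proof (cases w)
  case Nil
  have "runs scan_tm 1 (Begin, 0, tape_of []) (Pass2 q0 [3], 1, tape_of [3])"
    by (intro runs_step[where d = GoRight and a = 3]) (auto simp: scan_tm_simps fun_eq_iff tape_of_def)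
  moreover have "runs scan_tm 2 (Pass2 q0 [3], 1, tape_of [3]) (scan_config 0 (q0, [], []))"
    using runs_pass2[of "[]" 1 "[3]" "[3]" q0] by (simp add: scan_string_def numeral_2_eq_2)
  ultimately have "runs scan_tm (length w + K + 3) (Begin, 0, tape_of []) (scan_config 0 (q0, [], []))"
    by (rule runs_trans) simp
  moreover have "init_config scan_tm w = (Begin, 0, tape_of [])"
    by (simp add: Nil init_config_eq scan_tm_def)
  ultimately have 1: "runs scan_tm (length w + K + 3) (init_config scan_tm w) (scan_config 0 (q0, [], []))"
    by simp
  have l0: "length (scan_string 0 [] []) \<le> length w + K + 2" by (simp add: scan_string_def)
  have "proper (q0, [], [])" using states_Q by (auto simp: proper_def)
  then obtain a where "runs scan_tm (Suc N * (2 * (length w + K + 2 + Suc N * (K + 1)) + K + 10))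
     (scan_config 0 (q0, [], [])) (scan_config a ((pass_step ^^ Suc N) (q0, [], [])))"
    using runs_pass_steps[of q0 "[]" "[]" 0 "length w + K + 2" "Suc N", OF _ l0 refl] by blast
  from runs_trans[OF 1 this order.refl] show ?thesis
    unfolding Suc_eq_plus1 Nil by blast
next
  case (Cons b w')
  have b: "b = 1 \<or> b = 2" and w': "set w' \<subseteq> {1, 2}" using w Cons by auto
  obtain q' v where o: "out q0 b = (q', v)" by force
  have v: "length v \<le> K" "set v \<subseteq> {1, 2}" "q' \<in> Q" using out[of q0 b] states_Q b o by auto
  have "runs scan_tm 1 (Begin, 0, tape_of (b # w')) (Pass2 q' (3 # v), 1, tape_of (3 # w'))"
    using b tape_of_upd(1)[of "[]" b w' 3]
    by (intro runs_step[where d = GoRight and a = 3]) (auto simp: scan_tm_simps o)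
  moreover have "runs scan_tm (length w' + length v + 2) (Pass2 q' (3 # v), 1, tape_of (3 # w'))
      (scan_config 0 (q', w', v))"
    using runs_pass2[OF w', of 1 "[3]" "3 # v" q'] by (simp add: scan_string_def)
  ultimately have "runs scan_tm (length w + K + 3) (Begin, 0, tape_of (b # w')) (scan_config 0 (q', w', v))"
    by (rule runs_trans) (use v Cons in auto)
  then have 1: "runs scan_tm (length w + K + 3) (init_config scan_tm w) (scan_config 0 (q', w', v))"
    unfolding Cons init_config_eq by (simp add: scan_tm_def)
  have s: "pass_step (q0, w, []) = (q', w', v)"
    using states_Q by (simp add: Cons o)
  have "proper (q', w', v)" using w' v by (simp add: proper_def)
  moreover have "length (scan_string 0 w' v) \<le> length w + K + 2"
    using v(1) by (simp add: scan_string_def Cons)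
  ultimately obtain a where "runs scan_tm (N * (2 * (length w + K + 2 + N * (K + 1)) + K + 10))
     (scan_config 0 (q', w', v)) (scan_config a ((pass_step ^^ Suc N) (q0, w, [])))"
    using runs_pass_steps[of q' w' v 0 "length w + K + 2" N, OF _ _ refl]
    unfolding funpow_Suc_right comp_apply s by blast
  moreover have "N * (2 * (length w + K + 2 + N * (K + 1)) + K + 10) \<le>
      (N + 1) * (2 * (length w + K + 2 + (N + 1) * (K + 1)) + K + 10)"
    by (intro mult_le_mono add_mono) auto
  ultimately show ?thesis using runs_trans[OF 1] add_le_mono[OF order.refl] by blast
qed

end

section \<open>One pass for a step of an ordinary machine\<close>

definition unary :: "nat \<Rightarrow> nat list" where
  "unary c = replicate c 1 @ [2]"

definition unary_word :: "nat list \<Rightarrow> nat list" where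
  "unary_word cs = concat (map unary cs)"

lemma unary_word_simps [simp]:
  "unary_word [] = []" "unary_word (c # cs) = unary c @ unary_word cs"
  "unary_word (cs @ cs') = unary_word cs @ unary_word cs'"
  by (simp_all add: unary_word_def)

lemma length_unary [simp]: "length (unary c) = Suc c"
  by (simp add: unary_def)

lemma set_unary: "set (unary c) \<subseteq> {1, 2}"
  by (auto simp: unary_def)

lemma set_unary_word: "set (unary_word cs) \<subseteq> {1, 2}"
  using set_unary by (induction cs) auto

lemma length_unary_word:
  "(\<And>c. c \<in> set cs \<Longrightarrow> c < b) \<Longrightarrow> length (unary_word cs) \<le> length cs * b"
proof (induction cs)
  case (Cons c cs)
  then have "c < b" "length (unary_word cs) \<le> length cs * b" by simp_all
  then show ?case by simp
qed simp

text \<open>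
  The code of a cell is twice its symbol, plus 1 if the head is there. In the state
  \<open>Cells q H f c\<close>, the list \<open>H\<close> holds back the code of the previous cell, because the head may
  still move there, \<open>f\<close> tells that the head has moved right to the next cell, and \<open>c\<close> counts the
  ones of the current code. \<open>Letters s\<close> belongs to the first pass, which encodes the input; \<open>s\<close>
  tells that a letter has been read.
\<close>

datatype 'q cell_state = Letters bool | Cells 'q "nat list" bool nat

instance cell_state :: (countable) countable by countable_datatype

text \<open>The last two components are the new flag and the codes released to the output. In the
  left move \<open>H = []\<close> means that the head is on cell 0 and stays there; otherwise the
  held-back code receives the head mark and is released.\<close>

definition cell_delta ::
  "'q tm \<Rightarrow> 'q \<Rightarrow> nat list \<Rightarrow> bool \<Rightarrow> nat \<Rightarrow> 'q \<times> nat list \<times> bool \<times> nat list" where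
  "cell_delta M q H f c =
     (if f then (q, [c + 1], False, H)
      else if odd c then
        let (q', a, d) = delta M q (c div 2) in
          case d of
            GoLeft \<Rightarrow> if H = [] then (q', [2 * a + 1], False, []) else (q', [2 * a], False, [hd H + 1])
          | Stay \<Rightarrow> (q', [2 * a + 1], False, H)
          | GoRight \<Rightarrow> (q', [2 * a], True, H)
      else (q, [c], False, H))"

text \<open>The cap on the counter keeps the state set finite; codes of genuine cells are below
  twice the number of symbols and never exceed it. In the first pass the first letter receives the
  head mark.\<close>

fun cell_out :: "'q tm \<Rightarrow> 'q cell_state \<Rightarrow> nat \<Rightarrow> 'q cell_state \<times> nat list" where
  "cell_out M (Letters s) b = (Letters True, unary (2 * b + (if s then 0 else 1)))"
| "cell_out M (Cells q H f c) b =
     (if b = 1 then (Cells q H f (min (Suc c) (2 * num_symbols M - 1)), [])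
      else let (q', H', f', cs) = cell_delta M q H f c in (Cells q' H' f' 0, unary_word cs))"

fun cell_fin :: "'q tm \<Rightarrow> 'q cell_state \<Rightarrow> 'q cell_state \<times> nat list" where
  "cell_fin M (Letters s) = (Cells (start M) [] False 0, if s then [] else unary 1)"
| "cell_fin M (Cells q H f c) =
     (Cells q [] False 0, unary_word (H @ (if f then [1] else [])))"

text \<open>The bound on \<open>H\<close> is one more than the largest genuine code: the set must be
  closed under all transitions, and with the flag set an odd counter may also be increased.\<close>

definition cell_states :: "'q tm \<Rightarrow> 'q cell_state set" where
  "cell_states M = range Letters \<union> (\<lambda>(q, H, f, c). Cells q H f c) `
     (states M \<times> {H. set H \<subseteq> {..2 * num_symbols M} \<and> length H \<le> 1} \<times> UNIV \<times> {..<2 * num_symbols M})"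

lemma Cells_in [simp]:
  "Cells q H f c \<in> cell_states M \<longleftrightarrow> q \<in> states M \<and> set H \<subseteq> {..2 * num_symbols M} \<and> length H \<le> 1 \<and>
     c < 2 * num_symbols M"
  by (auto simp: cell_states_def image_iff)

lemma Letters_in [simp]: "Letters s \<in> cell_states M"
  by (simp add: cell_states_def)

section \<open>Correctness and length of the passes of an ordinary machine\<close>

locale ordinary_machine =
  fixes M :: "'q tm"
  assumes ordinary: "ordinary_tm M"
begin

abbreviation S :: nat where "S \<equiv> num_symbols M"

lemma S_ge: "S \<ge> 3" and wf: "wf_tm M"
  using ordinary by (auto simp: ordinary_tm_def)

lemma cell_delta_in:
  assumes "q \<in> states M" "set H \<subseteq> {..2 * S}" "length H \<le> 1" "c < 2 * S"
    and "cell_delta M q H f c = (q', H', f', cs)"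
  shows "q' \<in> states M \<and> set H' \<subseteq> {..2 * S} \<and> length H' = 1 \<and> set cs \<subseteq> {..<2 * S + 2} \<and> length cs \<le> 1"
proof -
  obtain p a d where d: "delta M q (c div 2) = (p, a, d)" by (metis prod_cases3)
  have "c div 2 < S" using assms by simp
  then have "delta M q (c div 2) \<in> states M \<times> {..<S} \<times> UNIV"
    using wf assms(1) unfolding wf_tm_def by metis
  with d have "p \<in> states M" "a < S" by auto
  then show ?thesis
    using assms by (cases H) (auto simp: cell_delta_def d split: if_splits dir.splits)
qed

text \<open>The halting states have \<open>H = []\<close> and counter 0. After a letter 1 the
  counter is positive, and after a complete code \<open>H\<close> is nonempty, so the pass machine
  can halt only at the end of a pass. The bound \<open>4 * S + 8\<close> is generous: an output
  consists of one code, or of a held-back code and a new blank cell.\<close>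

lemma pass_machine_cells:
  "pass_machine (cell_states M) (Letters False) (Cells (accept M) [] False 0)
     (Cells (reject M) [] False 0) (4 * S + 8) (cell_out M) (cell_fin M)"
proof
  have "finite {H. set H \<subseteq> {..2 * S} \<and> length H \<le> 1}" by (rule finite_lists_length_le) simp
  then show "finite (cell_states M)"
    using wf unfolding cell_states_def wf_tm_def
    by (intro finite_UnI finite_imageI finite_cartesian_product) auto
next
  fix s b assume s: "s \<in> cell_states M" and b: "b \<in> {1, 2 :: nat}"
  show "cell_out M s b \<in> (cell_states M - {Cells (accept M) [] False 0, Cells (reject M) [] False 0}) \<times>
      {u. set u \<subseteq> {1, 2} \<and> length u \<le> 4 * S + 8}"
  proof (cases s)
    case (Letters x)
    then show ?thesis using b set_unary[of "2 * b + (if x then 0 else 1)"] by auto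
  next
    case (Cells q H f c)
    show ?thesis
    proof (cases "b = 1")
      case True
      have "min (Suc c) (2 * S - 1) < 2 * S" "min (Suc c) (2 * S - 1) \<noteq> 0"
        using S_ge by auto
      then show ?thesis using True Cells s by auto
    next
      case False
      obtain q' H' f' cs where d: "cell_delta M q H f c = (q', H', f', cs)" by (metis prod_cases4)
      have "q' \<in> states M \<and> set H' \<subseteq> {..2 * S} \<and> length H' = 1 \<and> set cs \<subseteq> {..<2 * S + 2} \<and> length cs \<le> 1"
        using s Cells by (intro cell_delta_in[OF _ _ _ _ d]) auto
      moreover from this have "length (unary_word cs) \<le> length cs * (2 * S + 2)"
        by (intro length_unary_word) auto
      moreover from calculation have "length cs * (2 * S + 2) \<le> 1 * (2 * S + 2)"
        by (intro mult_le_mono1) auto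
      ultimately show ?thesis
        using S_ge False Cells d set_unary_word[of cs] by auto
    qed
  qed
next
  fix s assume s: "s \<in> cell_states M"
  show "cell_fin M s \<in> cell_states M \<times> {u. set u \<subseteq> {1, 2} \<and> length u \<le> 4 * S + 8}"
  proof (cases s)
    case (Letters x)
    then show ?thesis using S_ge wf set_unary[of 1] by (auto simp: wf_tm_def)
  next
    case (Cells q H f c)
    then have H: "q \<in> states M" "length H \<le> 1" "set H \<subseteq> {..2 * S}" using s by auto
    have "length (unary_word H) \<le> length H * (2 * S + 1)"
      using H by (intro length_unary_word) auto
    also have "\<dots> \<le> 1 * (2 * S + 1)" using H by (intro mult_le_mono1)
    finally show ?thesis
      using Cells H S_ge set_unary_word[of "H @ (if f then [1] else [])"] by auto
  qed
qed (use wf S_ge in \<open>auto simp: wf_tm_def\<close>)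

sublocale pass_machine "cell_states M" "Letters False" "Cells (accept M) [] False 0"
  "Cells (reject M) [] False 0" "4 * S + 8" "cell_out M" "cell_fin M"
  by (rule pass_machine_cells)

lemma read_ones:
  assumes "H \<noteq> [] \<or> q \<noteq> accept M \<and> q \<noteq> reject M" "j + i < 2 * S"
  shows "(pass_step ^^ i) (Cells q H f j, replicate i 1 @ w, u) = (Cells q H f (j + i), w, u)"
  using assms(2)
proof (induction i arbitrary: j)
  case (Suc i)
  have "pass_step (Cells q H f j, replicate (Suc i) 1 @ w, u) = (Cells q H f (Suc j), replicate i 1 @ w, u)"
    using assms(1) Suc.prems by auto
  then show ?case
    unfolding funpow_Suc_right comp_apply using Suc.IH[of "Suc j"] Suc.prems by simp
qed simp

lemma read_cell:
  assumes "H \<noteq> [] \<or> q \<noteq> accept M \<and> q \<noteq> reject M" "c < 2 * S"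
    and d: "cell_delta M q H f c = (q', H', f', cs)"
  shows "(pass_step ^^ Suc c) (Cells q H f 0, unary c @ w, u) = (Cells q' H' f' 0, w, u @ unary_word cs)"
proof -
  have "(pass_step ^^ c) (Cells q H f 0, unary c @ w, u) = (Cells q H f c, 2 # w, u)"
    using read_ones[of H q 0 c f "2 # w" u] assms by (simp add: unary_def)
  moreover have "pass_step (Cells q H f c, 2 # w, u) = (Cells q' H' f' 0, w, u @ unary_word cs)"
    using assms by auto
  ultimately show ?thesis by (simp only: funpow.simps comp_apply)
qed

definition cell :: "nat \<Rightarrow> (nat \<Rightarrow> nat) \<Rightarrow> nat \<Rightarrow> nat" where
  "cell h tape i = 2 * tape i + (if i = h then 1 else 0)"

lemma cell_less: "tape i < S \<Longrightarrow> cell h tape i < 2 * S"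
  by (cases "i = h") (simp_all add: cell_def)

text \<open>The loop invariant of a pass. Released and held-back codes together describe the cells
  read so far: those of the old configuration until the head's cell is read, those of the new one
  afterwards. After a right move the flag is pending for exactly one cell.\<close>

lemma pass_prefix:
  assumes q: "q \<in> states M" "q \<noteq> accept M" "q \<noteq> reject M"
    and h: "h < l" and tape: "\<And>i. tape i < S" and d: "delta M q (tape h) = (q', a, d)"
    and h': "h' = move_head d h" and tape': "tape' = tape(h := a)"
    and i: "i \<le> l"
  shows "\<exists>cs H. (pass_step ^^ length (unary_word (map (cell h tape) [0..<i])))
      (Cells q [] False 0, unary_word (map (cell h tape) [0..<l]), []) =
      (Cells (if i \<le> h then q else q') H (i = Suc h \<and> d = GoRight) 0,
       unary_word (map (cell h tape) [i..<l]), unary_word cs) \<and>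
    cs @ H = map (if i \<le> h then cell h tape else cell h' tape') [0..<i] \<and> length H = min i 1"
  using i
proof (induction i)
  case 0
  then show ?case by (intro exI[of _ "[]"]) simp
next
  case (Suc i)
  let ?w = "\<lambda>i. unary_word (map (cell h tape) [i..<l])"
  obtain cs H where run: "(pass_step ^^ length (unary_word (map (cell h tape) [0..<i])))
      (Cells q [] False 0, ?w 0, []) =
      (Cells (if i \<le> h then q else q') H (i = Suc h \<and> d = GoRight) 0, ?w i, unary_word cs)"
    and cs: "cs @ H = map (if i \<le> h then cell h tape else cell h' tape') [0..<i]"
    and H: "length H = min i 1"
    using Suc by auto
  let ?c = "cell h tape i" and ?q = "if i \<le> h then q else q'" and ?f = "i = Suc h \<and> d = GoRight"
  have c: "?c < 2 * S" using tape by (rule cell_less)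
  have w: "?w i = unary ?c @ ?w (Suc i)" using Suc.prems by (simp add: upt_conv_Cons)
  have ne: "H \<noteq> [] \<or> ?q \<noteq> accept M \<and> ?q \<noteq> reject M" using H q by (cases i) auto
  obtain p H' f' v where cd: "cell_delta M ?q H ?f ?c = (p, H', f', v)" by (metis prod_cases4)
  have "length (unary_word (map (cell h tape) [0..<Suc i])) =
      Suc ?c + length (unary_word (map (cell h tape) [0..<i]))" by simp
  then have "(pass_step ^^ length (unary_word (map (cell h tape) [0..<Suc i])))
      (Cells q [] False 0, ?w 0, []) = (Cells p H' f' 0, ?w (Suc i), unary_word cs @ unary_word v)"
    by (simp only: funpow_add comp_apply run w read_cell[OF ne c cd])
  moreover have "p = (if Suc i \<le> h then q else q') \<and> f' = (Suc i = Suc h \<and> d = GoRight) \<and>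
    (cs @ v) @ H' = map (if Suc i \<le> h then cell h tape else cell h' tape') [0..<Suc i] \<and>
    length H' = min (Suc i) 1"
  proof -
    consider "i < h" | "i = h" | "i > h" by linarith
    then show ?thesis
    proof cases
      case 1
      then have "(p, H', f', v) = (q, [?c], False, H)" using cd by (simp add: cell_delta_def cell_def)
      then show ?thesis using 1 cs by simp
    next
      case 2
      have old: "map (cell h tape) [0..<j] = map (cell h' tape') [0..<j]"
        if "j \<le> h" "h' \<ge> j" for j
        using that by (auto simp: cell_def tape')
      have c': "odd ?c" "?c div 2 = tape h" using 2 by (simp_all add: cell_def)
      show ?thesis
      proof (cases d)
        case Stay
        then have "(p, H', f', v) = (q', [2 * a + 1], False, H)"
          using cd 2 c' d by (simp add: cell_delta_def)
        moreover have "cell h' tape' h = 2 * a + 1" using h' Stay by (simp add: cell_def tape')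
        ultimately show ?thesis using 2 cs old[of h] h' Stay by simp
      next
        case GoRight
        then have "(p, H', f', v) = (q', [2 * a], True, H)"
          using cd 2 c' d by (simp add: cell_delta_def)
        moreover have "cell h' tape' h = 2 * a" using h' GoRight by (simp add: cell_def tape')
        ultimately show ?thesis using 2 cs old[of h] h' GoRight by simp
      next
        case GoLeft
        show ?thesis
        proof (cases h)
          case 0
          then have "(p, H', f', v) = (q', [2 * a + 1], False, [])"
            using cd 2 c' d GoLeft H by (simp add: cell_delta_def)
          moreover have "cell h' tape' h = 2 * a + 1" using h' GoLeft 0 by (simp add: cell_def tape')
          ultimately show ?thesis using 2 cs 0 GoLeft by simp
        next
          case (Suc j)
          \<comment> \<open>The code held back is that of the left neighbour \<open>j\<close>, the
            only earlier cell that changes.\<close>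
          have "cs @ H = map (cell h tape) [0..<j] @ [cell h tape j]" using cs 2 Suc by simp
          moreover obtain x where "H = [x]" using H 2 Suc by (cases H) auto
          ultimately have x: "H = [2 * tape j]" "cs = map (cell h tape) [0..<j]"
            using Suc by (auto simp: cell_def)
          then have "(p, H', f', v) = (q', [2 * a], False, [2 * tape j + 1])"
            using cd 2 c' d GoLeft by (simp add: cell_delta_def)
          moreover have "cell h' tape' h = 2 * a" "cell h' tape' j = 2 * tape j + 1"
            using h' GoLeft Suc by (simp_all add: cell_def tape')
          ultimately show ?thesis using 2 Suc x old[of j] h' GoLeft by simp
        qed
      qed
    next
      case 3
      show ?thesis
      proof (cases ?f)
        case True
        then have "(p, H', f', v) = (q', [?c + 1], False, H)" using cd 3 by (simp add: cell_delta_def)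
        moreover have "cell h' tape' i = ?c + 1" using True h' by (simp add: cell_def tape')
        ultimately show ?thesis using 3 cs by simp
      next
        case False
        have "h' \<noteq> i" using 3 False h' by (cases d) auto
        then have "cell h' tape' i = ?c" using 3 by (simp add: cell_def tape')
        moreover have "(p, H', f', v) = (q', [?c], False, H)"
          using cd 3 False by (simp add: cell_delta_def cell_def)
        ultimately show ?thesis using 3 cs by simp
      qed
    qed
  qed
  ultimately show ?case by (intro exI[of _ "cs @ v"] exI[of _ H']) simp
qed

text \<open>The represented segment grows only when the head leaves it on the right: then the flag
  is still set at the end of the pass, and \<open>cell_fin\<close> appends the code 1 of a blank
  cell with the head.\<close>

lemma pass_simulates_step:
  assumes q: "q \<in> states M"
    and h: "h < l" and tape: "\<And>i. tape i < S" "\<And>i. i \<ge> l \<Longrightarrow> tape i = 0"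
    and step: "step M (q, h, tape) = (q', h', tape')"
  shows "\<exists>n l'. n \<le> l * (2 * S) + 1 \<and> l \<le> l' \<and> l' \<le> Suc l \<and> h' < l' \<and> (\<forall>i\<ge>l'. tape' i = 0) \<and>
    (pass_step ^^ n) (Cells q [] False 0, unary_word (map (cell h tape) [0..<l]), []) =
      (Cells q' [] False 0, unary_word (map (cell h' tape') [0..<l']), [])"
proof (cases "q = accept M \<or> q = reject M")
  case True
  show ?thesis by (rule exI[of _ 0], rule exI[of _ l]) (use True assms in auto)
next
  case False
  obtain p a d where d: "delta M q (tape h) = (p, a, d)" by (metis prod_cases3)
  have S: "q' = p" "h' = move_head d h" "tape' = tape(h := a)"
    using step step_delta[of M q tape h, OF d] False by auto
  let ?w = "unary_word (map (cell h tape) [0..<l])"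
  let ?f = "l = Suc h \<and> d = GoRight"
  define l' where "l' = (if ?f then Suc l else l)"
  have nh: "q \<noteq> accept M" "q \<noteq> reject M" using False by simp_all
  have lh: "(l \<le> h) = False" and w0: "unary_word (map (cell h tape) [l..<l]) = []"
    using h by simp_all
  obtain cs H where run: "(pass_step ^^ length ?w) (Cells q [] False 0, ?w, []) =
      (Cells p H ?f 0, [], unary_word cs)"
    and cs: "cs @ H = map (cell h' tape') [0..<l]" and H: "length H = min l 1"
    using pass_prefix[OF q nh h tape(1) d S(2,3) order.refl, unfolded lh if_False w0]
    by (elim exE conjE) (rule that)
  have len: "length ?w \<le> length (map (cell h tape) [0..<l]) * (2 * S)"
    using tape(1) by (intro length_unary_word) (auto intro: cell_less)
  have "H \<noteq> []" using H h by auto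
  then have "pass_step (Cells p H ?f 0, [], unary_word cs) =
      (Cells p [] False 0, unary_word ((cs @ H) @ (if ?f then [1] else [])), [])"
    by auto
  also have "(cs @ H) @ (if ?f then [1] else []) = map (cell h' tape') [0..<l']"
    unfolding cs using S h tape(2)[of l] by (auto simp: l'_def cell_def)
  finally have "(pass_step ^^ Suc (length ?w)) (Cells q [] False 0, ?w, []) =
      (Cells q' [] False 0, unary_word (map (cell h' tape') [0..<l']), [])"
    unfolding S(1) by (simp only: funpow.simps comp_apply run)
  have "h' < l'" using S h by (cases d) (auto simp: l'_def)
  have "\<forall>i\<ge>l'. tape' i = 0" using S h tape(2) by (auto simp: l'_def)
  have "l \<le> l'" "l' \<le> Suc l" by (simp_all add: l'_def)
  have "Suc (length ?w) \<le> l * (2 * S) + 1" using len by simp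
  show ?thesis
    by (rule exI[of _ "Suc (length ?w)"], rule exI[of _ l'], intro conjI) fact+
qed

lemma read_letters:
  "(pass_step ^^ length w) (Letters True, w, u) = (Letters True, [], u @ unary_word (map (\<lambda>b. 2 * b) w))"
  by (induction w arbitrary: u) (simp_all add: funpow_swap1)

text \<open>The maximum with 1 reflects that an empty input becomes one blank cell, so that the head
  always lies inside the represented segment.\<close>

lemma first_pass:
  "(pass_step ^^ Suc (length w)) (Letters False, w, []) =
     (Cells (start M) [] False 0, unary_word (map (cell 0 (tape_of w)) [0..<max 1 (length w)]), [])"
proof (cases w)
  case Nil
  then show ?thesis by (simp add: cell_def)
next
  case (Cons b v)
  have "[0..<length w] = 0 # map Suc [0..<length v]"
    by (simp add: Cons upt_conv_Cons map_Suc_upt del: upt_Suc)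
  then have "map (cell 0 (tape_of w)) [0..<length w] =
      (2 * b + 1) # map (\<lambda>b. 2 * b) (map (tape_of v) [0..<length v])"
    by (simp add: Cons cell_def del: upt_Suc)
  also have "map (tape_of v) [0..<length v] = v"
    by (rule nth_equalityI) (simp_all add: tape_of_def)
  finally have codes: "map (cell 0 (tape_of w)) [0..<length w] = (2 * b + 1) # map (\<lambda>b. 2 * b) v" .
  have "pass_step (Letters False, b # v, []) = (Letters True, v, unary (2 * b + 1))"
    by simp
  then have "(pass_step ^^ length w) (Letters False, w, []) =
      (Letters True, [], unary_word (map (cell 0 (tape_of w)) [0..<length w]))"
    unfolding codes unfolding Cons list.size(4) add_0_right add_Suc_right funpow_Suc_right comp_apply
    by (simp only: read_letters unary_word_simps)
  then have "(pass_step ^^ Suc (length w)) (Letters False, w, []) =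
      pass_step (Letters True, [], unary_word (map (cell 0 (tape_of w)) [0..<length w]))"
    by (simp only: funpow.simps comp_apply)
  also have "\<dots> = (Cells (start M) [] False 0, unary_word (map (cell 0 (tape_of w)) [0..<length w]), [])"
    by simp
  finally have "(pass_step ^^ Suc (length w)) (Letters False, w, []) =
      (Cells (start M) [] False 0, unary_word (map (cell 0 (tape_of w)) [0..<length w]), [])" .
  moreover have "max 1 (length w) = length w" by (simp add: Cons)
  ultimately show ?thesis by (simp only:)
qed

lemma passes_simulate_steps:
  assumes w: "\<And>x. x \<in> set w \<Longrightarrow> x < S"
    and m: "(step M ^^ m) (init_config M w) = (q, h, tape)"
  shows "\<exists>n l. n \<le> length w + m * ((length w + 1 + m) * (2 * S) + 1) \<and>
    (pass_step ^^ Suc n) (Letters False, w, []) =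
      (Cells q [] False 0, unary_word (map (cell h tape) [0..<l]), [])"
proof -
  have "q \<in> states M \<and> (\<forall>i. tape i < S) \<and> (\<exists>n l. h < l \<and> l \<le> length w + 1 + m \<and> (\<forall>i\<ge>l. tape i = 0) \<and>
    n \<le> length w + m * ((length w + 1 + m) * (2 * S) + 1) \<and>
    (pass_step ^^ Suc n) (Letters False, w, []) =
      (Cells q [] False 0, unary_word (map (cell h tape) [0..<l]), []))"
    using m
  proof (induction m arbitrary: q h tape)
    case 0
    then have c: "q = start M" "h = 0" "tape = tape_of w" by (auto simp: init_config_eq)
    have "tape_of w i < S" for i using w S_ge by (auto simp: tape_of_def)
    moreover have t0: "tape_of w i = 0" if "i \<ge> max 1 (length w)" for i
      using that by (auto simp: tape_of_def)
    moreover have "\<exists>n l. 0 < l \<and> l \<le> length w + 1 + 0 \<and> (\<forall>i\<ge>l. tape_of w i = 0) \<and>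
      n \<le> length w + 0 * ((length w + 1 + 0) * (2 * S) + 1) \<and>
      (pass_step ^^ Suc n) (Letters False, w, []) =
        (Cells (start M) [] False 0, unary_word (map (cell 0 (tape_of w)) [0..<l]), [])"
      by (rule exI[of _ "length w"], rule exI[of _ "max 1 (length w)"])
        (use first_pass[of w] t0 in \<open>simp del: funpow.simps pass_step.simps\<close>)
    ultimately show ?case using wf unfolding c wf_tm_def by blast
  next
    case (Suc m)
    obtain q1 h1 t1 where c1: "(step M ^^ m) (init_config M w) = (q1, h1, t1)"
      by (metis prod_cases3)
    have s: "step M (q1, h1, t1) = (q, h, tape)"
      using Suc.prems c1 by (simp del: step.simps)
    obtain n l where q1: "q1 \<in> states M" "\<And>i. t1 i < S" and l: "h1 < l" "l \<le> length w + 1 + m"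
      "\<And>i. i \<ge> l \<Longrightarrow> t1 i = 0"
      and n: "n \<le> length w + m * ((length w + 1 + m) * (2 * S) + 1)"
      and run: "(pass_step ^^ Suc n) (Letters False, w, []) =
        (Cells q1 [] False 0, unary_word (map (cell h1 t1) [0..<l]), [])"
      using Suc.IH[OF c1] by blast
    obtain n' l' where l': "n' \<le> l * (2 * S) + 1" "l' \<le> Suc l" "h < l'" "\<forall>i\<ge>l'. tape i = 0"
      and run': "(pass_step ^^ n') (Cells q1 [] False 0, unary_word (map (cell h1 t1) [0..<l]), []) =
        (Cells q [] False 0, unary_word (map (cell h tape) [0..<l']), [])"
      using pass_simulates_step[OF q1(1) l(1) q1(2) l(3) s] by blast
    have "Suc (n' + n) = n' + Suc n" by simp
    then have "(pass_step ^^ Suc (n' + n)) (Letters False, w, []) =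
        (Cells q [] False 0, unary_word (map (cell h tape) [0..<l']), [])"
      by (simp only: funpow_add comp_apply run run')
    moreover have "n' + n \<le> length w + Suc m * ((length w + 1 + Suc m) * (2 * S) + 1)"
    proof -
      have "l * (2 * S) \<le> (length w + 1 + Suc m) * (2 * S)" using l by (intro mult_le_mono1) simp
      moreover have "m * ((length w + 1 + m) * (2 * S) + 1) \<le> m * ((length w + 1 + Suc m) * (2 * S) + 1)"
        by (intro mult_le_mono add_mono) auto
      ultimately show ?thesis using n l'(1) unfolding mult_Suc[of m] by linarith
    qed
    moreover have "l' \<le> length w + 1 + Suc m" using l l' by linarith
    ultimately have "\<exists>n l. h < l \<and> l \<le> length w + 1 + Suc m \<and> (\<forall>i\<ge>l. tape i = 0) \<and>
      n \<le> length w + Suc m * ((length w + 1 + Suc m) * (2 * S) + 1) \<and>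
      (pass_step ^^ Suc n) (Letters False, w, []) =
        (Cells q [] False 0, unary_word (map (cell h tape) [0..<l]), [])"
      using l'(3,4) by blast
    moreover have "q \<in> states M" "\<forall>i. tape i < S"
      using step_in_bounds[OF wf q1 s] by blast+
    ultimately show ?case by (intro conjI)
  qed
  then show ?thesis by blast
qed

text \<open>With \<open>Y = X * X\<close>, both the number of pass steps and the cost of each are at
  most a constant times \<open>Y\<close>; their product gives \<open>X ^ 4\<close>.\<close>

lemma scan_time_bound:
  fixes n m X N c K :: nat
  assumes X: "n + m + 1 \<le> X" and c: "c = 2 * S + 2" and N: "N \<le> n + m * ((n + 1 + m) * (2 * S) + 1)"
  shows "n + K + 3 + (N + 1) * (2 * (n + K + 2 + (N + 1) * (K + 1)) + K + 10) \<le>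
    (K + 4 + c * (2 * (K + 3 + c * (K + 1)) + K + 10)) * X ^ 4"
proof -
  define Y where "Y = X * X"
  have X1: "X \<ge> 1" using X by simp
  then have XY: "X \<le> Y" unfolding Y_def by simp
  have Y: "1 \<le> Y" "n \<le> Y" using X XY X1 by linarith+
  have "m * ((n + 1 + m) * (2 * S) + 1) \<le> X * (X * (2 * S) + 1)"
    using X by (intro mult_le_mono add_mono) auto
  also have "\<dots> = Y * (2 * S) + X" by (simp add: Y_def algebra_simps)
  also have "\<dots> \<le> Y * (2 * S) + Y" using XY by simp
  finally have "N + 1 \<le> X + Y * (2 * S) + Y" using N X by linarith
  also have "\<dots> \<le> c * Y" using XY unfolding c by (simp add: algebra_simps)
  finally have B: "N + 1 \<le> c * Y" .
  have KY: "k \<le> k * Y" for k using Y(1) by simp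
  have aux2: "x * (Y * Y) + (c * Y) * (y * Y) = (x + c * y) * (Y * Y)" for x y
    by (simp add: algebra_simps)
  have aux: "2 * x + K + 10 \<le> 2 * y + z" if "x \<le> y" "K + 10 \<le> z" for x y z :: nat
    using that by linarith
  have "n + K + 2 + (N + 1) * (K + 1) \<le> Y + (K + 2) * Y + (c * Y) * (K + 1)"
    using Y B KY[of "K + 2"] mult_le_mono1[OF B, of "K + 1"] by linarith
  also have "\<dots> = (K + 3 + c * (K + 1)) * Y" by (simp add: algebra_simps)
  finally have "2 * (n + K + 2 + (N + 1) * (K + 1)) + K + 10 \<le>
      2 * ((K + 3 + c * (K + 1)) * Y) + (K + 10) * Y"
    using KY[of "K + 10"] by (rule aux)
  also have "\<dots> = (2 * (K + 3 + c * (K + 1)) + K + 10) * Y" by (simp add: algebra_simps)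
  finally have "(N + 1) * (2 * (n + K + 2 + (N + 1) * (K + 1)) + K + 10) \<le>
      (c * Y) * ((2 * (K + 3 + c * (K + 1)) + K + 10) * Y)"
    by (rule mult_le_mono[OF B])
  moreover have "n + K + 3 \<le> (K + 4) * (Y * Y)"
  proof -
    have "n + K + 3 \<le> (K + 4) * Y" using Y(2) KY[of "K + 3"] by (simp add: algebra_simps)
    also have "\<dots> \<le> (K + 4) * (Y * Y)" using Y(1) by simp
    finally show ?thesis .
  qed
  ultimately have "n + K + 3 + (N + 1) * (2 * (n + K + 2 + (N + 1) * (K + 1)) + K + 10) \<le>
      (K + 4) * (Y * Y) + (c * Y) * ((2 * (K + 3 + c * (K + 1)) + K + 10) * Y)"
    by (rule add_le_mono[rotated])
  also have "\<dots> = (K + 4 + c * (2 * (K + 3 + c * (K + 1)) + K + 10)) * (Y * Y)"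
    by (rule aux2)
  also have "Y * Y = X ^ 4" by (simp add: Y_def power4_eq_xxxx)
  finally show ?thesis .
qed

theorem decides_block_tm:
  assumes "decides_in_time M input_tm L T"
  shows "\<exists>D. decides_in_time (block_tm scan_tm) input_wotm L (\<lambda>n. D * (n + T n + 1) ^ 4)"
proof -
  define K where "K = 4 * S + 8"
  define c where "c = 2 * S + 2"
  define D where "D = K + 4 + c * (2 * (K + 3 + c * (K + 1)) + K + 10)"
  \<comment> \<open>The factor 4 counts the steps of \<open>block_tm\<close> for one step of
    \<open>scan_tm\<close>.\<close>
  have "decides_in_time (block_tm scan_tm) input_wotm L (\<lambda>n. 4 * D * (n + T n + 1) ^ 4)"
  proof (rule decides_in_timeI[OF _ assms])
    fix w m x
    assume m: "m \<le> T (length w)" and x: "(step M ^^ m) (init_config M (input_tm w)) = x"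
    obtain q h tape where x': "x = (q, h, tape)" by (metis prod_cases3)
    have len: "length (input_tm w) = length w" and set: "set (input_tm w) \<subseteq> {1, 2}"
      by (auto simp: input_tm_def)
    obtain n v where n: "n \<le> length w + m * ((length w + 1 + m) * (2 * S) + 1)"
      and pass: "(pass_step ^^ Suc n) (Letters False, input_tm w, []) = (Cells q [] False 0, v, [])"
      using passes_simulate_steps[of "input_tm w" m q h tape] set S_ge x x' unfolding len by fastforce
    obtain a where "runs scan_tm (length w + K + 3 + (n + 1) * (2 * (length w + K + 2 + (n + 1) * (K + 1)) + K + 10))
      (init_config scan_tm (input_tm w)) (scan_config a (Cells q [] False 0, v, []))"
      using runs_init[OF set, of n] unfolding pass len K_def[symmetric] by blast
    then obtain m' where m': "m' \<le> length w + K + 3 + (n + 1) * (2 * (length w + K + 2 + (n + 1) * (K + 1)) + K + 10)"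
      and run: "(step scan_tm ^^ m') (init_config scan_tm (input_tm w)) = scan_config a (Cells q [] False 0, v, [])"
      unfolding runs_def by blast
    have "length w + m + 1 \<le> length w + T (length w) + 1" using m by simp
    from scan_time_bound[OF this c_def n, of K] m' have "m' \<le> D * (length w + T (length w) + 1) ^ 4"
      unfolding D_def by linarith
    then have "4 * m' \<le> 4 * D * (length w + T (length w) + 1) ^ 4" by simp
    moreover have "fst ((step (block_tm scan_tm) ^^ (4 * m')) (init_config (block_tm scan_tm) (input_wotm w))) =
        Read (Emit (Cells q [] False 0) [])"
      using block_steps[OF monotone4_scan_tm run[unfolded scan_config.simps]] by simp
    ultimately show "\<exists>m'\<le>4 * D * (length w + T (length w) + 1) ^ 4.
        \<exists>c'. (step (block_tm scan_tm) ^^ m') (init_config (block_tm scan_tm) (input_wotm w)) = c' \<and>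
          (fst x = accept M \<longrightarrow> fst c' = accept (block_tm scan_tm)) \<and>
          (fst x = reject M \<longrightarrow> fst c' = reject (block_tm scan_tm))"
      unfolding x' by (intro exI[of _ "4 * m'"]) (simp add: block_tm_def scan_tm_simps)
  qed
  then show ?thesis by blast
qed

end

theorem k_EXPTIME_subset: "k_EXPTIME k \<subseteq> k_DEXPWOTIME k"
proof
  fix L assume "L \<in> k_EXPTIME k"
  then obtain M :: "nat tm" and T where M: "ordinary_tm M"
    and dec: "decides_in_time M input_tm L T" and T: "exp_tower_bounded k T"
    unfolding k_EXPTIME_def by blast
  interpret ordinary_machine M by (rule ordinary_machine.intro[OF M])
  obtain D where "decides_in_time (block_tm scan_tm) input_wotm L (\<lambda>n. D * (n + T n + 1) ^ 4)"
    using decides_block_tm[OF dec] by blast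
  then have "decides_in_time (rename_tm (block_tm scan_tm)) input_wotm L (\<lambda>n. D * (n + T n + 1) ^ 4)"
    by (rule decides_rename_tm)
  moreover have "exp_tower_bounded k (\<lambda>n. D * (n + T n + 1) ^ 4)"
    by (rule exp_tower_bounded_poly[OF T, of 4 _ D]) auto
  moreover have "write_once_tm (rename_tm (block_tm scan_tm))"
    by (intro write_once_rename_tm write_once_block_tm monotone4_scan_tm)
  ultimately show "L \<in> k_DEXPWOTIME k"
    unfolding k_DEXPWOTIME_def by blast
qed

theorem theorem4:
  fixes k :: nat
  shows "k_DEXPWOTIME k = k_EXPTIME k"
  using k_DEXPWOTIME_subset k_EXPTIME_subset by (rule equalityI)

end
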